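(* Let $1<p<\infty$, $m,k\geq1$ and $\alpha,\beta\in\mathbb{R}$ be such that $Q\geq\alpha-\beta$. Then, with $n=m+k$, for all complex-valued $f\in C^{\infty}_{0}(\mathbb{R}^{m+k}\setminus\{(0,0)\})$, $$\int_{\mathbb{R}^n}|x|^{\beta-\gamma p}\rho^{(1+\gamma)p-\alpha}|\nabla_{\gamma}f|^{p}\,dz=\left(\frac{Q+\beta-\alpha}{p}\right)^{p}\int_{\mathbb{R}^n}\frac{|x|^{\beta}}{\rho^{\alpha}}|f|^{p}\,dz+\int_{\mathbb{R}^n}|x|^{\beta-\gamma p}\rho^{(1+\gamma)p-\alpha}\,C_{p}\left(\nabla_{\gamma}f,\rho^{-\frac{Q+\beta-\alpha}{p}}\nabla_{\gamma}\left(\frac{f}{\rho^{-\frac{Q+\beta-\alpha}{p}}}\right)\right)dz.$$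
   Context: Baouendi–Grushin setting: $\gamma\geq0$ is a real number, points are $z=(x,y)\in\mathbb{R}^{m}\times\mathbb{R}^{k}=\mathbb{R}^{m+k}$, $|\cdot|$ is the Euclidean norm and $dz$ is Lebesgue measure. The gradient is $\nabla_{\gamma}=(\nabla_x,|x|^{\gamma}\nabla_y)$. The homogeneous dimension is $Q=m+(1+\gamma)k$, and $$\rho=\rho(z)=\left(|x|^{2(1+\gamma)}+(1+\gamma)^2|y|^2\right)^{\frac{1}{2(1+\gamma)}}.$$ $C_0^\infty(\Omega)$ is the space of smooth functions compactly supported in $\Omega$. For $1<p<\infty$ and $\xi,\eta\in\mathbb{C}^{n}$, $$C_p(\xi,\eta):=|\xi|^p-|\xi-\eta|^p-p|\xi-\eta|^{p-2}\,\mathrm{Re}\big((\xi-\eta)\cdot\overline{\eta}\big)\ \ (\geq0),$$ the last term being read as $0$ when $\xi=\eta$. *)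

theory Defs
  imports "HOL-Analysis.Analysis"
begin

fun Ck_on :: "nat \<Rightarrow> 'a::real_normed_vector set \<Rightarrow> ('a \<Rightarrow> 'b::real_normed_vector) \<Rightarrow> bool" where
  "Ck_on 0 S f \<longleftrightarrow> continuous_on S f"
| "Ck_on (Suc n) S f \<longleftrightarrow>
     (\<forall>z\<in>S. f differentiable (at z)) \<and>
     (\<forall>v. Ck_on n S (\<lambda>z. frechet_derivative f (at z) v))"

text \<open>Meant for open sets only: the derivatives are unrestricted ones, taken at points of the set.\<close>

definition smooth_on_open :: "'a::real_normed_vector set \<Rightarrow> ('a \<Rightarrow> 'b::real_normed_vector) \<Rightarrow> bool" where
  "smooth_on_open S f \<longleftrightarrow> (\<forall>n. Ck_on n S f)"

text \<open>Elements of \<open>C\<^sub>0\<^sup>\<infinity>(\<Omega>)\<close> are represented by total functions that vanish outside \<open>\<Omega>\<close>;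
  the closure below is taken in the whole space.\<close>

definition test_functions :: "'a::real_normed_vector set \<Rightarrow> ('a \<Rightarrow> 'b::real_normed_vector) set" where
  "test_functions \<Omega> = {f. smooth_on_open \<Omega> f \<and>
     compact (closure {z. f z \<noteq> 0}) \<and> closure {z. f z \<noteq> 0} \<subseteq> \<Omega>}"

definition hom_dim :: "nat \<Rightarrow> nat \<Rightarrow> real \<Rightarrow> real" where
  "hom_dim m k \<gamma> = real m + (1 + \<gamma>) * real k"

definition rho :: "real \<Rightarrow> (real^'m::finite) \<times> (real^'k::finite) \<Rightarrow> real" where
  "rho \<gamma> z = (norm (fst z) powr (2 * (1 + \<gamma>)) + (1 + \<gamma>)\<^sup>2 * (norm (snd z))\<^sup>2)
               powr (1 / (2 * (1 + \<gamma>)))"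

definition partial_deriv :: "('a::real_normed_vector \<Rightarrow> 'b::real_normed_vector) \<Rightarrow> 'a \<Rightarrow> 'a \<Rightarrow> 'b" where
  "partial_deriv f v z = vector_derivative (\<lambda>t. f (z + t *\<^sub>R v)) (at 0)"

text \<open>The gradient takes values in \<open>\<complex>\<^sup>m\<^sup>+\<^sup>k\<close>, with coordinates indexed by the disjoint
  union of the two index types. The case distinction makes \<open>\<bar>x\<bar>\<^sup>0 = 1\<close> also at \<open>x = 0\<close>,
  whereas \<open>0 powr 0 = 0\<close>.\<close>

definition grad :: "real \<Rightarrow> ((real^'m::finite) \<times> (real^'k::finite) \<Rightarrow> complex)
    \<Rightarrow> (real^'m) \<times> (real^'k) \<Rightarrow> complex^('m + 'k)" where
  "grad \<gamma> f z = (\<chi> l. case l of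
      Inl i \<Rightarrow> partial_deriv f (axis i 1, 0) z
    | Inr j \<Rightarrow> (if \<gamma> = 0 then 1 else norm (fst z) powr \<gamma>) *\<^sub>R partial_deriv f (0, axis j 1) z)"

definition cdot :: "complex^'n::finite \<Rightarrow> complex^'n \<Rightarrow> complex" where
  "cdot \<xi> \<eta> = (\<Sum>l\<in>UNIV. \<xi> $ l * \<eta> $ l)"

definition cnj_vec :: "complex^'n::finite \<Rightarrow> complex^'n" where
  "cnj_vec \<eta> = (\<chi> l. cnj (\<eta> $ l))"

text \<open>For \<open>\<xi> = \<eta>\<close> the last term is 0, whatever the sign of \<open>p - 2\<close>.\<close>

definition C_p :: "real \<Rightarrow> complex^'n::finite \<Rightarrow> complex^'n \<Rightarrow> real" where
  "C_p p \<xi> \<eta> = norm \<xi> powr p - norm (\<xi> - \<eta>) powr p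
     - p * norm (\<xi> - \<eta>) powr (p - 2) * Re (cdot (\<xi> - \<eta>) (cnj_vec \<eta>))"

lemma Re_cdot_cnj_vec: "Re (cdot \<xi> (cnj_vec \<eta>)) = \<xi> \<bullet> \<eta>"
  by (simp add: cdot_def cnj_vec_def inner_vec_def inner_complex_def)

text \<open>Nonnegativity of \<open>C_p\<close> guarantees that \<open>ennreal (C_p p \<xi> \<eta>)\<close> does not truncate.\<close>

lemma C_p_nonneg:
  assumes "1 < p"
  shows "0 \<le> C_p p \<xi> \<eta>"
proof -
  define a where "a = \<xi> - \<eta>"
  show ?thesis
  proof (cases "a = 0")
    case True
    then show ?thesis by (simp add: C_p_def a_def)
  next
    case False
    define s t where "s = norm a" and "t = norm \<xi>"
    have s: "0 < s" and t: "0 \<le> t" using False by (auto simp: s_def t_def)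
    have *: "p * (s powr (p - 1) * t) \<le> (p - 1) * s powr p + t powr p"
    proof (cases "t = 0")
      case True
      then show ?thesis using assms s by simp
    next
      case False
      with t have t: "0 < t" by simp
      have "(s powr p) powr ((p - 1) / p) * (t powr p) powr (1 / p)
          \<le> (p - 1) / p * s powr p + 1 / p * t powr p"
        using assms s t by (intro Youngs_inequality_0) (auto simp: field_simps)
      then have "s powr (p - 1) * t \<le> ((p - 1) * s powr p + t powr p) / p"
        using assms t by (simp add: powr_powr add_divide_distrib)
      then show ?thesis using assms by (simp add: field_simps)
    qed
    have "a \<bullet> \<eta> = a \<bullet> \<xi> - s\<^sup>2"
      by (simp add: a_def s_def power2_norm_eq_inner inner_diff_left inner_diff_right)
    moreover have "a \<bullet> \<xi> \<le> s * t"
      unfolding s_def t_def by (rule norm_cauchy_schwarz)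
    ultimately have "p * s powr (p - 2) * (a \<bullet> \<eta>) \<le> p * s powr (p - 2) * (s * t - s\<^sup>2)"
      using assms by (intro mult_left_mono) auto
    also have "\<dots> = p * (s powr (p - 1) * t) - p * s powr p"
      using s by (simp add: powr_diff field_simps power2_eq_square)
    finally show ?thesis
      using * unfolding C_p_def Re_cdot_cnj_vec
      by (simp add: a_def[symmetric] s_def t_def algebra_simps)
  qed
qed

end

theory Submission
  imports Defs
begin

text \<open>Let \<open>E\<close> be the derivative along the generator \<open>(x, (1 + \<gamma>) y)\<close> of the anisotropic dilations, and put
\<open>c = (Q + \<beta> - \<alpha>) / p\<close>, \<open>u = |f|\<^sup>p\<close>, \<open>W = |x|\<^sup>\<beta> / rho\<^sup>\<alpha>\<close> and \<open>w = |x|\<^sup>\<beta>\<^sup>-\<^sup>\<gamma>\<^sup>p rho\<^sup>(\<^sup>1\<^sup>+\<^sup>\<gamma>\<^sup>)\<^sup>p\<^sup>-\<^sup>\<alpha>\<close>. The difference of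
the two arguments of \<open>C_p\<close> is \<open>- c f / rho\<close> times the gradient of \<open>rho\<close>. The latter has norm
\<open>(|x| / rho)\<^sup>\<gamma>\<close> and is proportional to the direction of the dilations, so that expanding \<open>C_p\<close> gives, wherever
\<open>x \<noteq> 0\<close>,
\<open>w C_p = w |grad f|\<^sup>p - c\<^sup>p W u + c\<^sup>p\<^sup>-\<^sup>1 W (E u + c p u)\<close>
(lemma \<open>weighted_C_p_eq\<close>). The theorem says that the last term contributes nothing to the integral.

Formally that is the divergence theorem: \<open>W\<close> is homogeneous of degree \<open>\<beta> - \<alpha>\<close>, so that the divergence
of \<open>W\<close> times the generator is \<open>(Q + \<beta> - \<alpha>) W = c p W\<close>. For \<open>\<beta> \<le> - m\<close>, however, \<open>W\<close> is not locally
integrable at \<open>x = 0\<close>, and each of the integrals may be infinite. The dilations avoid this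
difficulty, because they preserve the set \<open>x = 0\<close>: once \<open>W u\<close> and \<open>W (E u)\<close> are integrable, averaging
the scaling relation of the integral over one unit of time and applying the fundamental theorem of
calculus along the orbits gives the claim (\<open>integral_generator_eq_0\<close>).

It remains to control the infinite values. If the gradient integral is finite, then so is the
integral of \<open>W |E f|\<^sup>p\<close> (\<open>weighted_euler_le\<close>). Since a large dilation moves the support of \<open>f\<close> off itself,
\<open>f\<close> is recovered by integrating \<open>E f\<close> over a bounded time, and a Hardy inequality
(\<open>nn_integral_norm_powr_le_euler\<close>) shows that the integral of \<open>W u\<close> is finite; Young's inequality
then gives the integrability of \<open>W (E u)\<close>. If the gradient integral is infinite, coercivity of \<open>C_p\<close>
(\<open>norm_powr_le_C_p\<close>) forces one of the two integrals on the right to be infinite. For \<open>c = 0\<close> the first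
term on the right vanishes and the other two integrands agree almost everywhere.\<close>

section \<open>The anisotropic dilations\<close>

text \<open>The time parameter is additive, so that the dilation by the factor \<open>exp t\<close> is a flow; its generator
is the field \<open>(x, (1 + \<gamma>) y)\<close>.\<close>
definition dil :: "real \<Rightarrow> real \<Rightarrow> (real^'m::finite) \<times> (real^'k::finite) \<Rightarrow> (real^'m) \<times> (real^'k)" where
  "dil \<gamma> t z = (exp t *\<^sub>R fst z, exp ((1 + \<gamma>) * t) *\<^sub>R snd z)"

lemma dil_0 [simp]: "dil \<gamma> 0 z = z"
  by (simp add: dil_def)

lemma continuous_on_dil [continuous_intros]:
  assumes "continuous_on S a" "continuous_on S b"
  shows "continuous_on S (\<lambda>x. dil \<gamma> (a x) (b x))"
  unfolding dil_def by (intro continuous_intros assms)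

lemma measurable_dil [measurable]:
  "case_prod (dil \<gamma>) \<in> borel_measurable (borel \<Otimes>\<^sub>M borel)"
proof -
  have "continuous_on UNIV (\<lambda>p. dil \<gamma> (fst p) (snd p))"
    by (intro continuous_intros)
  then have "(\<lambda>p. dil \<gamma> (fst p) (snd p)) \<in> borel_measurable borel"
    by (rule borel_measurable_continuous_onI)
  then show ?thesis
    by (simp add: borel_prod case_prod_unfold)
qed

text \<open>The map is diagonal, and its determinant is \<open>exp t\<close> to the homogeneous dimension.\<close>
lemma lborel_dil:
  fixes \<gamma> t :: real
  shows "(lborel :: ((real^'m::finite) \<times> (real^'k::finite)) measure) =
    density (distr lborel borel (dil \<gamma> t)) (\<lambda>_. ennreal (exp (hom_dim CARD('m) CARD('k) \<gamma> * t)))"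
proof -
  define c :: "(real^'m) \<times> (real^'k) \<Rightarrow> real"
    where "c = (\<lambda>j. if snd j = 0 then exp t else exp ((1 + \<gamma>) * t))"
  have c0: "c j \<noteq> 0" for j by (simp add: c_def)
  have T: "0 + (\<Sum>j\<in>Basis. (c j * (x \<bullet> j)) *\<^sub>R j) = dil \<gamma> t x" for x
  proof (rule euclidean_eqI)
    fix b :: "(real^'m) \<times> (real^'k)" assume b: "b \<in> Basis"
    have "(0 + (\<Sum>j\<in>Basis. (c j * (x \<bullet> j)) *\<^sub>R j)) \<bullet> b = c b * (x \<bullet> b)"
      using b by (simp add: inner_sum_left_Basis)
    also have "\<dots> = dil \<gamma> t x \<bullet> b"
      using b by (auto simp: Basis_prod_def c_def dil_def inner_prod_def)
    finally show "(0 + (\<Sum>j\<in>Basis. (c j * (x \<bullet> j)) *\<^sub>R j)) \<bullet> b = dil \<gamma> t x \<bullet> b" .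
  qed
  have "(\<Prod>j\<in>Basis. \<bar>c j\<bar>) = exp t ^ CARD('m) * exp ((1 + \<gamma>) * t) ^ CARD('k)"
  proof -
    have "(\<Prod>j\<in>(\<lambda>u. (u, 0)) ` (Basis :: (real^'m) set). \<bar>c j\<bar>) = exp t ^ CARD('m)"
      by (subst prod.reindex) (auto simp: inj_on_def c_def)
    moreover have "(\<Prod>j\<in>(\<lambda>v. (0, v)) ` (Basis :: (real^'k) set). \<bar>c j\<bar>) = exp ((1 + \<gamma>) * t) ^ CARD('k)"
      by (subst prod.reindex) (auto simp: inj_on_def c_def nonzero_Basis intro!: trans[OF prod.cong[OF refl] prod_constant])
    ultimately show ?thesis
      unfolding Basis_prod_def by (subst prod.union_disjoint) auto
  qed
  also have "\<dots> = exp (hom_dim CARD('m) CARD('k) \<gamma> * t)"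
    by (simp add: hom_dim_def exp_add[symmetric] exp_of_nat_mult[symmetric] algebra_simps)
  finally have "(\<Prod>j\<in>Basis. \<bar>c j\<bar>) = exp (hom_dim CARD('m) CARD('k) \<gamma> * t)" .
  from lborel_affine_euclidean[of c 0, OF c0, unfolded T this] show ?thesis .
qed

text \<open>A weight that is homogeneous of degree \<open>d\<close> turns Lebesgue measure into a measure that scales under
the dilations with exponent \<open>Q + d\<close>.\<close>
lemma nn_integral_weight_dil:
  fixes W :: "(real^'m::finite) \<times> (real^'k::finite) \<Rightarrow> real"
  assumes [measurable]: "W \<in> borel_measurable borel" "g \<in> borel_measurable borel"
    and W: "\<And>z. 0 \<le> W z" "\<And>z. W (dil \<gamma> t z) = exp (d * t) * W z"
  shows "(\<integral>\<^sup>+z. ennreal (W z) * g (dil \<gamma> t z) \<partial>lborel) =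
    ennreal (exp (- (hom_dim CARD('m) CARD('k) \<gamma> + d) * t)) * (\<integral>\<^sup>+z. ennreal (W z) * g z \<partial>lborel)"
proof -
  let ?Q = "hom_dim CARD('m) CARD('k) \<gamma>"
  have "(\<integral>\<^sup>+z. ennreal (W z) * g z \<partial>lborel) =
      ennreal (exp (?Q * t)) * (\<integral>\<^sup>+z. ennreal (W (dil \<gamma> t z)) * g (dil \<gamma> t z) \<partial>lborel)"
    by (subst lborel_dil[of \<gamma> t]) (simp add: nn_integral_density nn_integral_distr nn_integral_cmult)
  also have "\<dots> = ennreal (exp (?Q * t)) * ennreal (exp (d * t)) * (\<integral>\<^sup>+z. ennreal (W z) * g (dil \<gamma> t z) \<partial>lborel)"
    by (simp add: W ennreal_mult mult.assoc nn_integral_cmult)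
  finally have eq: "(\<integral>\<^sup>+z. ennreal (W z) * g z \<partial>lborel) =
      ennreal (exp (?Q * t)) * ennreal (exp (d * t)) * (\<integral>\<^sup>+z. ennreal (W z) * g (dil \<gamma> t z) \<partial>lborel)" .
  have "exp (- (?Q + d) * t) * (exp (?Q * t) * exp (d * t)) = exp (- (?Q + d) * t + (?Q * t + d * t))"
    by (simp only: exp_add)
  also have "- (?Q + d) * t + (?Q * t + d * t) = 0"
    by (simp add: algebra_simps)
  finally have "ennreal (exp (- (?Q + d) * t)) * (ennreal (exp (?Q * t)) * ennreal (exp (d * t))) = 1"
    by (metis ennreal_mult ennreal_1 exp_ge_zero exp_zero mult_nonneg_nonneg)
  then show ?thesis
    unfolding eq mult.assoc[symmetric] by simp
qed

lemma has_bochner_integral_weight_dil: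
  fixes W h :: "(real^'m::finite) \<times> (real^'k::finite) \<Rightarrow> real"
  assumes [measurable]: "W \<in> borel_measurable borel" "h \<in> borel_measurable borel"
    and W: "\<And>z. W (dil \<gamma> t z) = exp (d * t) * W z"
    and int: "integrable lborel (\<lambda>z. W z * h z)"
  shows "has_bochner_integral lborel (\<lambda>z. exp ((hom_dim CARD('m) CARD('k) \<gamma> + d) * t) * (W z * h (dil \<gamma> t z)))
           (\<integral>z. W z * h z \<partial>lborel)"
proof -
  let ?Q = "hom_dim CARD('m) CARD('k) \<gamma>"
  have eq: "exp ((?Q + d) * t) * (W z * h (dil \<gamma> t z)) = exp (?Q * t) * (W (dil \<gamma> t z) * h (dil \<gamma> t z))" for z
    by (simp only: W distrib_right[of ?Q d t] exp_add mult.assoc mult.left_commute)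
  have "integrable lborel (\<lambda>z. exp (?Q * t) * (W (dil \<gamma> t z) * h (dil \<gamma> t z)))"
    using int by (subst (asm) lborel_dil[of \<gamma> t]) (subst (asm) integrable_density; simp add: integrable_distr_eq)
  moreover have "(\<integral>z. W z * h z \<partial>lborel) = (\<integral>z. exp (?Q * t) * (W (dil \<gamma> t z) * h (dil \<gamma> t z)) \<partial>lborel)"
    by (subst lborel_dil[of \<gamma> t]) (simp add: integral_density integral_distr)
  ultimately show ?thesis
    unfolding eq has_bochner_integral_iff by metis
qed

text \<open>This replaces integration by parts. The hypothesis on the derivative says that \<open>h\<close> is
\<open>E u + \<kappa> u\<close>, where \<open>E\<close> generates the dilations and \<open>\<kappa> = Q + d\<close>. For every \<open>t\<close> the substitution
\<open>z \<mapsto> dil \<gamma> t z\<close> shows that \<open>exp (\<kappa> t) W(z) h(dil \<gamma> t z)\<close> has the same integral as \<open>W h\<close>. Averaging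
over \<open>0 \<le> t \<le> 1\<close> and exchanging the integrals, the inner integral over \<open>t\<close> is
\<open>W(z) (exp \<kappa> u(dil \<gamma> 1 z) - u(z))\<close>, whose integral over \<open>z\<close> vanishes by the same substitution.
As integrability is asked of \<open>W u\<close> and \<open>W h\<close> alone, weights that are not locally integrable are
covered.\<close>
lemma integral_generator_eq_0:
  fixes W u h :: "(real^'m::finite) \<times> (real^'k::finite) \<Rightarrow> real"
  assumes [measurable]: "W \<in> borel_measurable borel"
    and W: "\<And>t z. W (dil \<gamma> t z) = exp (d * t) * W z"
    and cont: "continuous_on UNIV u" "continuous_on UNIV h"
    and int: "integrable lborel (\<lambda>z. W z * u z)" "integrable lborel (\<lambda>z. W z * h z)"
    and deriv: "\<And>t z. ((\<lambda>t. exp ((hom_dim CARD('m) CARD('k) \<gamma> + d) * t) * u (dil \<gamma> t z))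
      has_real_derivative exp ((hom_dim CARD('m) CARD('k) \<gamma> + d) * t) * h (dil \<gamma> t z)) (at t)"
  shows "(\<integral>z. W z * h z \<partial>lborel) = 0"
proof -
  define \<kappa> where "\<kappa> = hom_dim CARD('m) CARD('k) \<gamma> + d"
  have [measurable]: "u \<in> borel_measurable borel" "h \<in> borel_measurable borel"
    using cont by (auto intro: borel_measurable_continuous_onI)
  note wd = has_bochner_integral_weight_dil[where W = W and d = d and \<gamma> = \<gamma>, OF _ _ W, folded \<kappa>_def]
  \<comment> \<open>The integrand whose double integral is computed in both orders.\<close>
  define H where "H = (\<lambda>t z. indicator {0..1} t * (exp (\<kappa> * t) * (W z * h (dil \<gamma> t z))))"
  have Hm: "case_prod H \<in> borel_measurable (lborel \<Otimes>\<^sub>M lborel)"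
    unfolding H_def by measurable
  have I: "has_bochner_integral lborel (\<lambda>z. exp (\<kappa> * t) * (W z * h (dil \<gamma> t z))) (\<integral>z. W z * h z \<partial>lborel)" for t
    by (rule wd) (use int in auto)
  have In: "(\<integral>z. norm (H t z) \<partial>lborel) = indicator {0..1} t * (\<integral>z. \<bar>W z\<bar> * \<bar>h z\<bar> \<partial>lborel)" for t
  proof -
    have "has_bochner_integral lborel (\<lambda>z. exp (\<kappa> * t) * (\<bar>W z\<bar> * \<bar>h (dil \<gamma> t z)\<bar>)) (\<integral>z. \<bar>W z\<bar> * \<bar>h z\<bar> \<partial>lborel)"
      unfolding \<kappa>_def
      by (rule has_bochner_integral_weight_dil)
        (use integrable_abs[OF int(2)] in \<open>auto simp: W abs_mult\<close>)
    then show ?thesis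
      by (auto simp: H_def abs_mult has_bochner_integral_iff)
  qed
  have Hi: "integrable (lborel \<Otimes>\<^sub>M lborel) (case_prod H)"
  proof (rule lborel_pair.Fubini_integrable[OF Hm])
    show "integrable lborel (\<lambda>t. \<integral>z. norm (case (t, z) of (x, xa) \<Rightarrow> H x xa) \<partial>lborel)"
      by (simp only: prod.case In) simp
    show "AE t in lborel. integrable lborel (\<lambda>z. case (t, z) of (x, xa) \<Rightarrow> H x xa)"
    proof (rule AE_I2)
      fix t :: real
      show "integrable lborel (\<lambda>z. case (t, z) of (x, xa) \<Rightarrow> H x xa)"
        using I[of t] by (auto simp: H_def has_bochner_integral_iff)
    qed
  qed
  have tz: "(\<integral>t. H t z \<partial>lborel) = W z * (exp \<kappa> * u (dil \<gamma> 1 z)) - W z * u z" for z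
  proof -
    have "(\<integral>t. indicator {0..1} t *\<^sub>R (exp (\<kappa> * t) * h (dil \<gamma> t z)) \<partial>lborel)
        = exp (\<kappa> * 1) * u (dil \<gamma> 1 z) - exp (\<kappa> * 0) * u (dil \<gamma> 0 z)"
    proof (rule integral_FTC_atLeastAtMost)
      show "continuous_on {0..1} (\<lambda>t. exp (\<kappa> * t) * h (dil \<gamma> t z))"
        by (intro continuous_intros continuous_on_compose2[OF cont(2)]) auto
      show "((\<lambda>t. exp (\<kappa> * t) * u (dil \<gamma> t z)) has_vector_derivative exp (\<kappa> * t) * h (dil \<gamma> t z))
          (at t within {0..1})" for t
        using deriv[of z t, folded \<kappa>_def]
        by (simp add: has_real_derivative_iff_has_vector_derivative has_vector_derivative_at_within)
    qed simp
    moreover have "(\<lambda>t. H t z) = (\<lambda>t. W z * (indicator {0..1} t *\<^sub>R (exp (\<kappa> * t) * h (dil \<gamma> t z))))"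
      by (auto simp: H_def)
    ultimately show ?thesis by (simp only: integral_mult_right_zero) (simp add: right_diff_distrib)
  qed
  have "(\<integral>z. W z * h z \<partial>lborel) = (\<integral>t. \<integral>z. H t z \<partial>lborel \<partial>lborel)"
    using I by (simp add: H_def has_bochner_integral_iff)
  also have "\<dots> = (\<integral>z. \<integral>t. H t z \<partial>lborel \<partial>lborel)"
    using lborel_pair.Fubini_integral[OF Hi] by simp
  also have "\<dots> = (\<integral>z. W z * (exp \<kappa> * u (dil \<gamma> 1 z)) \<partial>lborel) - (\<integral>z. W z * u z \<partial>lborel)"
    unfolding tz using wd[OF _ _ int(1), of 1] int(1)
    by (subst Bochner_Integration.integral_diff) (auto simp: has_bochner_integral_iff mult.left_commute)
  also have "\<dots> = 0"
    using wd[OF _ _ int(1), of 1] by (simp add: has_bochner_integral_iff mult.left_commute)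
  finally show ?thesis .
qed

section \<open>Powers of the norm\<close>

text \<open>At the origin the right-hand side is 0, which is the derivative because \<open>p > 1\<close>.\<close>
lemma has_derivative_norm_powr:
  fixes a :: "'a::real_inner"
  assumes p: "1 < p"
  shows "((\<lambda>a. norm a powr p) has_derivative (\<lambda>h. p * norm a powr (p - 2) * (a \<bullet> h))) (at a)"
proof (cases "a = 0")
  case False
  then have "((\<lambda>a. norm a powr p) has_derivative (\<lambda>h. norm a powr p * (0 * ln (norm a) + (h \<bullet> sgn a) * p / norm a))) (at a)"
    by (intro has_derivative_powr has_derivative_norm has_derivative_const) auto
  moreover have "norm a powr p * (0 * ln (norm a) + (h \<bullet> sgn a) * p / norm a)
      = p * norm a powr (p - 2) * (a \<bullet> h)" for h
    using False by (simp add: sgn_div_norm powr_diff inner_commute power2_eq_square divide_simps)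
  ultimately show ?thesis by simp
next
  case True
  have "((\<lambda>a :: 'a. norm a powr p) has_derivative (\<lambda>h. 0)) (at 0 within UNIV)"
  proof (rule has_derivativeI_sandwich[where e = 1 and H = "\<lambda>y. norm y powr (p - 1)"])
    fix y :: 'a assume "y \<noteq> 0"
    then show "norm (norm y powr p - norm (0::'a) powr p - 0) / norm (y - 0) \<le> norm y powr (p - 1)"
      by (simp add: powr_diff)
  next
    have "continuous_on UNIV (\<lambda>y::'a. norm y powr (p - 1))"
      using p by (intro continuous_on_powr' continuous_intros) auto
    then have "((\<lambda>y::'a. norm y powr (p - 1)) \<longlongrightarrow> norm (0::'a) powr (p - 1)) (at 0)"
      unfolding continuous_on_def by blast
    then show "((\<lambda>y::'a. norm y powr (p - 1)) \<longlongrightarrow> 0) (at 0)"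
      by simp
  qed auto
  with True show ?thesis by simp
qed

lemma continuous_on_norm_powr_scaleR:
  assumes p: "1 < p"
  shows "continuous_on UNIV (\<lambda>a :: 'a::real_normed_vector. norm a powr (p - 2) *\<^sub>R a)"
proof (rule continuous_at_imp_continuous_on, rule ballI)
  fix a :: 'a
  show "isCont (\<lambda>a. norm a powr (p - 2) *\<^sub>R a) a"
  proof (cases "a = 0")
    case False
    then show ?thesis by (intro continuous_intros) auto
  next
    case True
    have "continuous_on UNIV (\<lambda>y::'a. norm y powr (p - 1))"
      using p by (intro continuous_on_powr' continuous_intros) auto
    then have "((\<lambda>y::'a. norm y powr (p - 1)) \<longlongrightarrow> norm (0::'a) powr (p - 1)) (at 0)"
      unfolding continuous_on_def by blast
    moreover have "norm (norm y powr (p - 2) *\<^sub>R y) = norm y powr (p - 1)" for y :: 'a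
      by (cases "y = 0") (simp_all add: powr_diff power2_eq_square)
    ultimately have "((\<lambda>y::'a. norm (norm y powr (p - 2) *\<^sub>R y)) \<longlongrightarrow> 0) (at 0)"
      by (simp only:) simp
    then have "((\<lambda>y::'a. norm y powr (p - 2) *\<^sub>R y) \<longlongrightarrow> 0) (at 0)"
      by (rule tendsto_norm_zero_cancel)
    then show ?thesis
      unfolding isCont_def True by simp
  qed
qed

text \<open>Young's inequality in the form of a tangent line: \<open>t\<^sup>p\<close> lies above its tangent at \<open>s\<close>.\<close>
lemma Young_powr:
  fixes s t p :: real
  assumes "1 < p" "0 \<le> s" "0 \<le> t"
  shows "p * (s powr (p - 1) * t) \<le> (p - 1) * s powr p + t powr p"
proof -
  have "t * s powr (p - 1) \<le> t powr p / p + (s powr (p - 1)) powr (p / (p - 1)) / (p / (p - 1))"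
    using assms by (intro Youngs_inequality) (auto simp: field_simps)
  also have "(s powr (p - 1)) powr (p / (p - 1)) = s powr p"
    using assms by (simp add: powr_powr)
  finally show ?thesis using assms by (simp add: field_simps)
qed

section \<open>The homogeneous norm and the gradient\<close>

lemma rho_base_pos:
  fixes z :: "(real^'m::finite) \<times> (real^'k::finite)"
  assumes "0 \<le> \<gamma>" "z \<noteq> 0"
  shows "0 < norm (fst z) powr (2 * (1 + \<gamma>)) + (1 + \<gamma>)\<^sup>2 * (norm (snd z))\<^sup>2"
proof (cases "fst z = 0")
  case True
  with assms have "snd z \<noteq> 0" by (auto simp: prod_eq_iff)
  with True assms show ?thesis by simp
next
  case False
  then show ?thesis by (intro add_pos_nonneg) auto
qed

lemma rho_pos: "0 \<le> \<gamma> \<Longrightarrow> z \<noteq> 0 \<Longrightarrow> 0 < rho \<gamma> z"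
  using rho_base_pos[of \<gamma> z] by (simp add: rho_def)

lemma rho_nonneg [simp]: "0 \<le> rho \<gamma> z"
  by (simp add: rho_def)

lemma rho_powr_base:
  assumes "0 \<le> \<gamma>"
  shows "rho \<gamma> z powr (2 * (1 + \<gamma>)) = norm (fst z) powr (2 * (1 + \<gamma>)) + (1 + \<gamma>)\<^sup>2 * (norm (snd z))\<^sup>2"
  using assms by (simp add: rho_def powr_powr)

lemma rho_dil:
  assumes "0 \<le> \<gamma>"
  shows "rho \<gamma> (dil \<gamma> t z) = exp t * rho \<gamma> z"
proof -
  let ?N = "norm (fst z) powr (2 * (1 + \<gamma>)) + (1 + \<gamma>)\<^sup>2 * (norm (snd z))\<^sup>2"
  have "norm (fst (dil \<gamma> t z)) powr (2 * (1 + \<gamma>)) + (1 + \<gamma>)\<^sup>2 * (norm (snd (dil \<gamma> t z)))\<^sup>2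
      = exp (2 * (1 + \<gamma>) * t) * ?N"
    by (simp add: dil_def powr_mult exp_powr_real power_mult_distrib exp_double[symmetric] algebra_simps)
  then have "rho \<gamma> (dil \<gamma> t z) = exp (2 * (1 + \<gamma>) * t) powr (1 / (2 * (1 + \<gamma>))) * rho \<gamma> z"
    unfolding rho_def by (simp add: powr_mult)
  also have "exp (2 * (1 + \<gamma>) * t) powr (1 / (2 * (1 + \<gamma>))) = exp t"
    using assms by (simp add: exp_powr_real)
  finally show ?thesis .
qed

lemma continuous_on_rho:
  assumes "0 \<le> \<gamma>"
  shows "continuous_on S (rho \<gamma>)"
  unfolding rho_def using assms by (intro continuous_on_powr' continuous_intros) auto

lemma measurable_rho [measurable]: "0 \<le> \<gamma> \<Longrightarrow> rho \<gamma> \<in> borel_measurable borel"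
  by (intro borel_measurable_continuous_onI continuous_on_rho)

text \<open>The power is arbitrary so that one computation serves for \<open>rho\<close> and for the factor by which \<open>f\<close> is
divided. It is the chain rule for the power \<open>s / (2 (1 + \<gamma>))\<close> of
\<open>|x|\<^sup>2\<^sup>(\<^sup>1\<^sup>+\<^sup>\<gamma>\<^sup>) + (1 + \<gamma>)\<^sup>2 |y|\<^sup>2\<close>.\<close>
lemma has_derivative_rho_powr:
  fixes z :: "(real^'m::finite) \<times> (real^'k::finite)"
  assumes \<gamma>: "0 \<le> \<gamma>" and z: "z \<noteq> 0"
  shows "((\<lambda>w. rho \<gamma> w powr s) has_derivative
    (\<lambda>v. s * rho \<gamma> z powr (s - 2 * \<gamma> - 2) *
      (norm (fst z) powr (2 * \<gamma>) * (fst z \<bullet> fst v) + (1 + \<gamma>) * (snd z \<bullet> snd v)))) (at z)"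
proof -
  define N where "N = (\<lambda>w :: (real^'m) \<times> (real^'k). norm (fst w) powr (2 * (1 + \<gamma>)) + (1 + \<gamma>)\<^sup>2 * (snd w \<bullet> snd w))"
  define e where "e = s / (2 * (1 + \<gamma>))"
  have rho: "rho \<gamma> w powr s' = N w powr (s' / (2 * (1 + \<gamma>)))" for w s'
    by (simp add: rho_def N_def powr_powr power2_norm_eq_inner)
  have Npos: "0 < N z"
    using rho_base_pos[OF \<gamma> z] by (simp add: N_def power2_norm_eq_inner)
  let ?D = "\<lambda>v. norm (fst z) powr (2 * \<gamma>) * (fst z \<bullet> fst v) + (1 + \<gamma>) * (snd z \<bullet> snd v)"
  have "((\<lambda>w. norm (fst w) powr (2 * (1 + \<gamma>))) has_derivative
      (\<lambda>v. 2 * (1 + \<gamma>) * norm (fst z) powr (2 * (1 + \<gamma>) - 2) * (fst z \<bullet> fst v))) (at z)"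
    using \<gamma> by (intro has_derivative_compose[OF has_derivative_fst[OF has_derivative_ident]] has_derivative_norm_powr) auto
  then have "(N has_derivative (\<lambda>v. 2 * (1 + \<gamma>) * norm (fst z) powr (2 * (1 + \<gamma>) - 2) * (fst z \<bullet> fst v)
      + (1 + \<gamma>)\<^sup>2 * (snd z \<bullet> snd v + snd v \<bullet> snd z))) (at z)"
    unfolding N_def by (intro derivative_intros)
  moreover have "2 * (1 + \<gamma>) * norm (fst z) powr (2 * (1 + \<gamma>) - 2) * (fst z \<bullet> fst v)
      + (1 + \<gamma>)\<^sup>2 * (snd z \<bullet> snd v + snd v \<bullet> snd z) = 2 * (1 + \<gamma>) * ?D v" for v
    by (simp add: inner_commute algebra_simps power2_eq_square)
  ultimately have "(N has_derivative (\<lambda>v. 2 * (1 + \<gamma>) * ?D v)) (at z)"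
    by simp
  then have "((\<lambda>w. N w powr e) has_derivative
      (\<lambda>v. N z powr e * (0 * ln (N z) + 2 * (1 + \<gamma>) * ?D v * e / N z))) (at z)"
    by (intro has_derivative_powr has_derivative_const Npos) auto
  moreover have "N z powr e * (0 * ln (N z) + 2 * (1 + \<gamma>) * ?D v * e / N z)
      = s * rho \<gamma> z powr (s - 2 * \<gamma> - 2) * ?D v" for v
  proof -
    have "rho \<gamma> z powr (s - 2 * \<gamma> - 2) = N z powr (e - 1)"
      using \<gamma> unfolding rho by (intro arg_cong[of _ _ "(powr) (N z)"]) (simp add: e_def field_simps)
    moreover have "2 * (1 + \<gamma>) * e = s"
      using \<gamma> by (simp add: e_def)
    ultimately show ?thesis
      using Npos by (simp add: powr_diff)
  qed
  ultimately show ?thesis unfolding rho e_def by simp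
qed

lemma partial_deriv_eq:
  assumes "(f has_derivative f') (at z)"
  shows "partial_deriv f v z = f' v"
proof -
  have "((\<lambda>t. z + t *\<^sub>R v) has_derivative (\<lambda>t. t *\<^sub>R v)) (at 0)"
    by (auto intro!: derivative_eq_intros)
  then have "((\<lambda>t. f (z + t *\<^sub>R v)) has_derivative (\<lambda>t. f' (t *\<^sub>R v))) (at 0)"
    by (rule has_derivative_compose) (use assms in simp)
  moreover have "f' (t *\<^sub>R v) = t *\<^sub>R f' v" for t
    using assms by (simp add: has_derivative_def linear_simps)
  ultimately show ?thesis
    unfolding partial_deriv_def
    by (intro vector_derivative_at) (simp add: has_vector_derivative_def)
qed

section \<open>The pointwise form of the identity\<close>

text \<open>The derivative along the generator of the dilations.\<close>
definition euler :: "real \<Rightarrow> ((real^'m::finite) \<times> (real^'k::finite) \<Rightarrow> 'b::real_normed_vector) \<Rightarrow> (real^'m) \<times> (real^'k) \<Rightarrow> 'b" where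
  "euler \<gamma> f z = frechet_derivative f (at z) (fst z, (1 + \<gamma>) *\<^sub>R snd z)"

text \<open>The degenerate gradient \<open>(\<nabla>\<^sub>x, |x|\<^sup>\<gamma> \<nabla>\<^sub>y)\<close> of \<open>rho\<close> at points with \<open>x \<noteq> 0\<close>.\<close>
definition rho_grad :: "real \<Rightarrow> (real^'m::finite) \<times> (real^'k::finite) \<Rightarrow> real^('m + 'k)" where
  "rho_grad \<gamma> z = (\<chi> l. case l of
      Inl i \<Rightarrow> norm (fst z) powr (2 * \<gamma>) / rho \<gamma> z powr (2 * \<gamma> + 1) * fst z $ i
    | Inr j \<Rightarrow> norm (fst z) powr \<gamma> / rho \<gamma> z powr (2 * \<gamma> + 1) * ((1 + \<gamma>) * snd z $ j))"

lemma sum_UNIV_Plus: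
  fixes g :: "'a::finite + 'b::finite \<Rightarrow> 'c::comm_monoid_add"
  shows "(\<Sum>l\<in>UNIV. g l) = (\<Sum>i\<in>UNIV. g (Inl i)) + (\<Sum>j\<in>UNIV. g (Inr j))"
  by (simp add: UNIV_Plus_UNIV[symmetric] sum.Plus del: UNIV_Plus_UNIV)

lemma linear_prod_expand:
  fixes f' :: "(real^'m::finite) \<times> (real^'k::finite) \<Rightarrow> 'b::real_vector"
  assumes "linear f'"
  shows "f' (x, y) = (\<Sum>i\<in>UNIV. x $ i *\<^sub>R f' (axis i 1, 0)) + (\<Sum>j\<in>UNIV. y $ j *\<^sub>R f' (0, axis j 1))"
proof -
  have x: "x = (\<Sum>i\<in>UNIV. x $ i *\<^sub>R axis i 1)" for x :: "real^'n::finite"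
    by (simp add: basis_expansion flip: scalar_mult_eq_scaleR)
  have "(x, y) = (\<Sum>i\<in>UNIV. x $ i *\<^sub>R (axis i 1, 0)) + (\<Sum>j\<in>UNIV. y $ j *\<^sub>R (0, axis j 1))"
    using x[of x] x[of y] by (simp add: prod_eq_iff fst_sum snd_sum)
  then have "f' (x, y) = f' ((\<Sum>i\<in>UNIV. x $ i *\<^sub>R (axis i 1, 0)) + (\<Sum>j\<in>UNIV. y $ j *\<^sub>R (0, axis j 1)))"
    by (rule arg_cong)
  then show ?thesis
    by (simp only: linear_add[OF assms] linear_sum[OF assms] linear_cmul[OF assms])
qed

lemma grad_nth:
  assumes "(f has_derivative f') (at z)" "fst z \<noteq> 0"
  shows "grad \<gamma> f z $ Inl i = f' (axis i 1, 0)"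
    and "grad \<gamma> f z $ Inr j = norm (fst z) powr \<gamma> *\<^sub>R f' (0, axis j 1)"
  using assms by (auto simp: grad_def partial_deriv_eq)

lemma norm_vec_of_real_mult:
  fixes r :: "real^'n::finite" and w :: complex
  shows "norm (\<chi> l. of_real (r $ l) * w) = norm r * norm w"
  by (simp add: norm_vec_def norm_mult L2_set_left_distrib)

lemma inner_vec_of_real_mult:
  fixes r :: "real^'n::finite" and w :: complex
  shows "(\<chi> l. of_real (r $ l) * w) \<bullet> \<xi> = w \<bullet> (\<Sum>l\<in>UNIV. of_real (r $ l) * \<xi> $ l)"
  by (simp add: inner_vec_def inner_sum_right scaleR_conv_of_real[symmetric])

lemma norm_sum_of_real_mult_le:
  fixes r :: "real^'n::finite" and \<xi> :: "complex^'n"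
  shows "norm (\<Sum>l\<in>UNIV. of_real (r $ l) * \<xi> $ l) \<le> norm r * norm \<xi>"
proof -
  have "norm (\<Sum>l\<in>UNIV. of_real (r $ l) * \<xi> $ l) \<le> (\<Sum>l\<in>UNIV. \<bar>norm (r $ l)\<bar> * \<bar>norm (\<xi> $ l)\<bar>)"
    by (rule order_trans[OF norm_sum]) (simp add: norm_mult)
  also have "\<dots> \<le> norm r * norm \<xi>"
    unfolding norm_vec_def by (rule L2_set_mult_ineq)
  finally show ?thesis .
qed

text \<open>The square of the norm is \<open>|x|\<^sup>2\<^sup>\<gamma> rho\<^sup>-\<^sup>(\<^sup>4\<^sup>\<gamma>\<^sup>+\<^sup>2\<^sup>)\<close> times
\<open>|x|\<^sup>2\<^sup>(\<^sup>1\<^sup>+\<^sup>\<gamma>\<^sup>) + (1 + \<gamma>)\<^sup>2 |y|\<^sup>2 = rho\<^sup>2\<^sup>(\<^sup>1\<^sup>+\<^sup>\<gamma>\<^sup>)\<close>.\<close>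
lemma norm_rho_grad:
  assumes \<gamma>: "0 \<le> \<gamma>" and x: "fst z \<noteq> 0"
  shows "norm (rho_grad \<gamma> z) = norm (fst z) powr \<gamma> / rho \<gamma> z powr \<gamma>"
proof -
  define X R where "X = norm (fst z)" and "R = rho \<gamma> z"
  have "z \<noteq> 0" using x by auto
  then have X: "0 < X" and R: "0 < R" using x rho_pos[OF \<gamma>, of z] by (auto simp: X_def R_def)
  have n2: "(\<Sum>i\<in>UNIV. (v $ i)\<^sup>2) = (norm v)\<^sup>2" for v :: "real^'n::finite"
    by (simp add: norm_vec_def L2_set_def sum_nonneg)
  have sq: "(a powr b)\<^sup>2 = a powr (2 * b)" if "0 < a" for a b :: real
    using that by (simp add: power2_eq_square flip: powr_add)
  have e1: "X powr (2 * (1 + \<gamma>)) = X powr (2 * \<gamma>) * X\<^sup>2" and e2: "(X powr \<gamma>)\<^sup>2 = X powr (2 * \<gamma>)"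
    using X by (simp_all add: distrib_left powr_add sq)
  have e3: "(R powr (2 * \<gamma> + 1))\<^sup>2 = R powr (2 * (1 + \<gamma>)) * (R powr \<gamma>)\<^sup>2"
    using R by (simp add: sq algebra_simps flip: powr_add)
  have "(norm (rho_grad \<gamma> z))\<^sup>2 = (\<Sum>l\<in>UNIV. (rho_grad \<gamma> z $ l)\<^sup>2)"
    by (simp add: n2)
  also have "\<dots> = (X powr (2 * \<gamma>) / R powr (2 * \<gamma> + 1))\<^sup>2 * X\<^sup>2
      + (X powr \<gamma> / R powr (2 * \<gamma> + 1))\<^sup>2 * ((1 + \<gamma>)\<^sup>2 * (norm (snd z))\<^sup>2)"
    by (simp only: sum_UNIV_Plus rho_grad_def vec_lambda_beta sum.case power_mult_distrib
        sum_distrib_left[symmetric] n2 X_def R_def)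
  also have "\<dots> = (X powr \<gamma>)\<^sup>2 / (R powr (2 * \<gamma> + 1))\<^sup>2 * (X powr (2 * (1 + \<gamma>)) + (1 + \<gamma>)\<^sup>2 * (norm (snd z))\<^sup>2)"
    unfolding e1 e2 power_divide by (simp add: power2_eq_square add_divide_distrib distrib_left mult_ac)
  also have "X powr (2 * (1 + \<gamma>)) + (1 + \<gamma>)\<^sup>2 * (norm (snd z))\<^sup>2 = R powr (2 * (1 + \<gamma>))"
    by (simp only: X_def R_def rho_powr_base[OF \<gamma>])
  also have "(X powr \<gamma>)\<^sup>2 / (R powr (2 * \<gamma> + 1))\<^sup>2 * R powr (2 * (1 + \<gamma>)) = (X powr \<gamma> / R powr \<gamma>)\<^sup>2"
    using R by (simp add: e3 power_divide)
  finally show ?thesis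
    unfolding X_def R_def by (simp add: power2_eq_iff_nonneg)
qed

text \<open>The gradient of \<open>rho\<close> points, in the degenerate metric, along the generator of the dilations. This
is why the radial part of the gradient of \<open>f\<close> can be treated by means of the dilations alone.\<close>
lemma sum_rho_grad_grad:
  assumes \<gamma>: "0 \<le> \<gamma>" and x: "fst z \<noteq> 0" and f: "f differentiable (at z)"
  shows "(\<Sum>l\<in>UNIV. of_real (rho_grad \<gamma> z $ l) * grad \<gamma> f z $ l)
    = of_real (norm (fst z) powr (2 * \<gamma>) / rho \<gamma> z powr (2 * \<gamma> + 1)) * euler \<gamma> f z"
proof -
  define f' where "f' = frechet_derivative f (at z)"
  have D: "(f has_derivative f') (at z)"
    using f by (simp add: f'_def frechet_derivative_works)
  have X2: "norm (fst z) powr (2 * \<gamma>) = norm (fst z) powr \<gamma> * norm (fst z) powr \<gamma>"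
    by (simp flip: powr_add)
  have "euler \<gamma> f z = (\<Sum>i\<in>UNIV. of_real (fst z $ i) * f' (axis i 1, 0))
      + (\<Sum>j\<in>UNIV. of_real ((1 + \<gamma>) * snd z $ j) * f' (0, axis j 1))"
    unfolding euler_def f'_def[symmetric]
    by (subst linear_prod_expand[OF has_derivative_linear[OF D]]) (simp add: scaleR_conv_of_real[where 'a = complex])
  then show ?thesis
    unfolding rho_grad_def X2
    by (simp add: sum_UNIV_Plus grad_nth[OF D x] distrib_left sum_distrib_left sum_divide_distrib
        scaleR_conv_of_real mult_ac)
qed

text \<open>Product rule for \<open>f rho\<^sup>c\<close>: the term in which \<open>f\<close> is differentiated cancels.\<close>
lemma grad_diff_quotient:
  assumes \<gamma>: "0 \<le> \<gamma>" and x: "fst z \<noteq> 0" and f: "f differentiable (at z)"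
  shows "grad \<gamma> f z - rho \<gamma> z powr (- c) *\<^sub>R grad \<gamma> (\<lambda>w. f w / complex_of_real (rho \<gamma> w powr (- c))) z
    = (\<chi> l. of_real ((- (c / rho \<gamma> z) *\<^sub>R rho_grad \<gamma> z) $ l) * f z)"
proof -
  define f' where "f' = frechet_derivative f (at z)"
  define R where "R = rho \<gamma> z"
  define L where "L = (\<lambda>v. c * R powr (c - 2 * \<gamma> - 2) *
      (norm (fst z) powr (2 * \<gamma>) * (fst z \<bullet> fst v) + (1 + \<gamma>) * (snd z \<bullet> snd v)))"
  define g where "g = (\<lambda>w. f w / complex_of_real (rho \<gamma> w powr (- c)))"
  have z: "z \<noteq> 0" using x by auto
  have R: "0 < R" using rho_pos[OF \<gamma> z] by (simp add: R_def)
  have D: "(f has_derivative f') (at z)"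
    using f by (simp add: f'_def frechet_derivative_works)
  have g: "g = (\<lambda>w. rho \<gamma> w powr c *\<^sub>R f w)"
    by (auto simp: g_def powr_minus scaleR_conv_of_real divide_inverse)
  have Dg: "(g has_derivative (\<lambda>v. R powr c *\<^sub>R f' v + L v *\<^sub>R f z)) (at z)"
    unfolding g R_def L_def
    by (rule has_derivative_scaleR[OF has_derivative_rho_powr[OF \<gamma> z] D])
  have e: "R powr (- c) * (c * R powr (c - 2 * \<gamma> - 2)) = c / R / R powr (2 * \<gamma> + 1)"
    using R by (simp add: powr_minus powr_diff powr_add field_simps power2_eq_square)
  have cc: "R powr (- c) * R powr c = 1"
    using R by (simp flip: powr_add)
  have main: "R powr (- c) *\<^sub>R (R powr c *\<^sub>R a + L v *\<^sub>R b)
      = a + (c / R / R powr (2 * \<gamma> + 1) * (norm (fst z) powr (2 * \<gamma>) * (fst z \<bullet> fst v) + (1 + \<gamma>) * (snd z \<bullet> snd v))) *\<^sub>R b"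
    for a b :: complex and v
    by (simp only: scaleR_add_right scaleR_scaleR cc L_def mult.assoc[symmetric] e[unfolded mult.assoc[symmetric]] scaleR_one)
  note of_real = scaleR_conv_of_real[where 'a = complex]
  have "(grad \<gamma> f z - R powr (- c) *\<^sub>R grad \<gamma> g z) $ l
      = of_real ((- (c / R) *\<^sub>R rho_grad \<gamma> z) $ l) * f z" for l
  proof (cases l)
    case (Inl i)
    have "(grad \<gamma> f z - R powr (- c) *\<^sub>R grad \<gamma> g z) $ l
        = f' (axis i 1, 0) - R powr (- c) *\<^sub>R (R powr c *\<^sub>R f' (axis i 1, 0) + L (axis i 1, 0) *\<^sub>R f z)"
      by (simp add: Inl grad_nth[OF D x] grad_nth[OF Dg x])
    then show ?thesis
      unfolding main by (simp add: Inl rho_grad_def R_def[symmetric] inner_axis of_real)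
  next
    case (Inr j)
    have "(grad \<gamma> f z - R powr (- c) *\<^sub>R grad \<gamma> g z) $ l
        = norm (fst z) powr \<gamma> *\<^sub>R (f' (0, axis j 1)
          - R powr (- c) *\<^sub>R (R powr c *\<^sub>R f' (0, axis j 1) + L (0, axis j 1) *\<^sub>R f z))"
      by (simp add: Inr grad_nth[OF D x] grad_nth[OF Dg x] scaleR_right_diff_distrib mult.commute)
    then show ?thesis
      unfolding main by (simp add: Inr rho_grad_def R_def[symmetric] inner_axis of_real)
  qed
  then show ?thesis
    unfolding g_def R_def by (simp add: vec_eq_iff)
qed

text \<open>With \<open>a = \<xi> - \<eta>\<close> this substitutes \<open>\<eta> = \<xi> - a\<close> in the inner product. In this form \<open>C_p\<close> depends on \<open>\<xi>\<close>
and on the vector \<open>a\<close>, which is a multiple of \<open>rho_grad\<close> in the application.\<close>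
lemma C_p_alt:
  "C_p p \<xi> \<eta> = norm \<xi> powr p + (p - 1) * norm (\<xi> - \<eta>) powr p
     - p * norm (\<xi> - \<eta>) powr (p - 2) * ((\<xi> - \<eta>) \<bullet> \<xi>)"
proof -
  have "norm (\<xi> - \<eta>) powr (p - 2) * ((\<xi> - \<eta>) \<bullet> (\<xi> - \<eta>)) = norm (\<xi> - \<eta>) powr p"
    by (cases "\<xi> = \<eta>") (simp_all add: powr_diff power2_norm_eq_inner[symmetric])
  moreover have "(\<xi> - \<eta>) \<bullet> \<eta> = (\<xi> - \<eta>) \<bullet> \<xi> - (\<xi> - \<eta>) \<bullet> (\<xi> - \<eta>)"
    by (simp add: inner_diff_right)
  ultimately show ?thesis
    unfolding C_p_def Re_cdot_cnj_vec
    by (simp only: right_diff_distrib left_diff_distrib mult.assoc)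
qed

text \<open>The mixed term of \<open>C_p\<close> is absorbed by Young's inequality, at the cost of a multiple of
\<open>norm (\<xi> - \<eta>) powr p\<close>. This bound makes the remainder integral infinite whenever the gradient
integral is infinite and the integral of \<open>W |f|\<^sup>p\<close> is not.\<close>
lemma norm_powr_le_C_p:
  assumes p: "1 < p"
  shows "norm \<xi> powr p \<le> 2 * C_p p \<xi> \<eta> + 2 * (p - 1) * 2 powr (p / (p - 1)) * norm (\<xi> - \<eta>) powr p"
proof -
  define s t l where "s = norm (\<xi> - \<eta>)" and "t = norm \<xi>" and "l = 2 powr (1 / (p - 1))"
  \<comment> \<open>The scale \<open>l\<close> is chosen so that \<open>s\<^sup>p\<^sup>-\<^sup>1 t = (l s)\<^sup>p\<^sup>-\<^sup>1 (t / 2)\<close>; halving \<open>t\<close> gains the factor \<open>2\<^sup>-\<^sup>p \<le> 1/2\<close>.\<close>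
  have s: "0 \<le> s" and t: "0 \<le> t" and l: "0 < l" by (auto simp: s_def t_def l_def)
  have lp: "l powr (p - 1) = 2" "l powr p = 2 powr (p / (p - 1))"
    using p by (simp_all add: l_def powr_powr)
  have "s powr (p - 2) * ((\<xi> - \<eta>) \<bullet> \<xi>) \<le> s powr (p - 2) * (s * t)"
    unfolding s_def t_def by (intro mult_left_mono norm_cauchy_schwarz) simp
  also have "\<dots> = (l * s) powr (p - 1) * (t / 2)"
    using s l by (cases "s = 0") (simp_all add: powr_mult lp, simp add: powr_diff power2_eq_square)
  finally have "p * (s powr (p - 2) * ((\<xi> - \<eta>) \<bullet> \<xi>)) \<le> p * ((l * s) powr (p - 1) * (t / 2))"
    using p by simp
  also have "\<dots> \<le> (p - 1) * (l * s) powr p + (t / 2) powr p"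
    using p s t l by (intro Young_powr) auto
  also have "(l * s) powr p = 2 powr (p / (p - 1)) * s powr p"
    using s l by (simp add: powr_mult lp)
  also have "(t / 2) powr p \<le> t powr p / 2"
    using p t powr_mono[of 1 p "2::real"] by (simp add: powr_divide divide_simps mult_left_mono)
  finally have h: "p * (s powr (p - 2) * ((\<xi> - \<eta>) \<bullet> \<xi>))
      \<le> (p - 1) * (2 powr (p / (p - 1)) * s powr p) + t powr p / 2"
    by simp
  have "0 \<le> (p - 1) * s powr p"
    using p by simp
  moreover have "T \<le> 2 * (T + S - I) + 2 * B" if "I \<le> B + T / 2" "0 \<le> S" for T S I B :: real
    using that by (simp add: algebra_simps)
  ultimately show ?thesis
    using h unfolding C_p_alt s_def[symmetric] t_def[symmetric] mult.assoc by blast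
qed

text \<open>Here \<open>\<xi> - \<eta>\<close> is the multiple \<open>- c f / rho\<close> of \<open>rho_grad\<close>, so its norm is
\<open>c |f| |x|\<^sup>\<gamma> / rho\<^sup>\<gamma>\<^sup>+\<^sup>1\<close>, and its inner product with the gradient of \<open>f\<close> involves only the real part
of \<open>euler f\<close> times the conjugate of \<open>f\<close>. The powers of \<open>|x|\<close> and \<open>rho\<close> in \<open>w\<close> are exactly those that
turn both terms into \<open>W\<close>. In the last bracket, the first summand is \<open>E u\<close> for \<open>u = |f|\<^sup>p\<close> and the
second one is \<open>c p u\<close>.\<close>
lemma weighted_C_p_eq:
  fixes f :: "(real^'m::finite) \<times> (real^'k::finite) \<Rightarrow> complex" and c p \<alpha> \<beta> \<gamma> :: real
  defines "w \<equiv> \<lambda>z. norm (fst z) powr (\<beta> - \<gamma> * p) * rho \<gamma> z powr ((1 + \<gamma>) * p - \<alpha>)"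
    and "W \<equiv> \<lambda>z. norm (fst z) powr \<beta> / rho \<gamma> z powr \<alpha>"
    and "\<eta> \<equiv> \<lambda>z. rho \<gamma> z powr (- c) *\<^sub>R grad \<gamma> (\<lambda>w. f w / complex_of_real (rho \<gamma> w powr (- c))) z"
  assumes \<gamma>: "0 \<le> \<gamma>" and p: "1 < p" and c: "0 < c"
    and x: "fst z \<noteq> 0" and f: "f differentiable (at z)"
  shows "w z * norm (grad \<gamma> f z - \<eta> z) powr p = c powr p * (W z * norm (f z) powr p)"
    and "w z * C_p p (grad \<gamma> f z) (\<eta> z) = w z * norm (grad \<gamma> f z) powr p
      - c powr p * (W z * norm (f z) powr p)
      + c powr (p - 1) * (W z * (p * norm (f z) powr (p - 2) * (f z \<bullet> euler \<gamma> f z) + c * p * norm (f z) powr p))"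
proof -
  define X R F e where "X = norm (fst z)" and "R = rho \<gamma> z" and "F = norm (f z)"
    and "e = f z \<bullet> euler \<gamma> f z"
  define \<xi> a where "\<xi> = grad \<gamma> f z" and "a = \<xi> - \<eta> z"
  have z: "z \<noteq> 0" using x by auto
  have X: "0 < X" and R: "0 < R" and F: "0 \<le> F"
    using x rho_pos[OF \<gamma> z] by (auto simp: X_def R_def F_def)
  have a: "a = (\<chi> l. of_real ((- (c / R) *\<^sub>R rho_grad \<gamma> z) $ l) * f z)"
    unfolding a_def \<xi>_def \<eta>_def R_def by (rule grad_diff_quotient[OF \<gamma> x f])
  have na: "norm a = c * F * X powr \<gamma> / R powr (\<gamma> + 1)"
    unfolding a norm_vec_of_real_mult
    using R c by (simp add: norm_rho_grad[OF \<gamma> x] X_def R_def[symmetric] F_def powr_add field_simps)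
  have ia: "a \<bullet> \<xi> = - (c * X powr (2 * \<gamma>) / R powr (2 * \<gamma> + 2) * e)"
  proof -
    have "(\<Sum>l\<in>UNIV. of_real ((- (c / R) *\<^sub>R rho_grad \<gamma> z) $ l) * \<xi> $ l)
      = (\<Sum>l\<in>UNIV. - of_real (c / R) * (of_real (rho_grad \<gamma> z $ l) * \<xi> $ l))"
      by (intro sum.cong) auto
    also have "\<dots> = - (c / R) *\<^sub>R (\<Sum>l\<in>UNIV. of_real (rho_grad \<gamma> z $ l) * \<xi> $ l)"
      by (simp add: sum_distrib_left scaleR_conv_of_real sum_negf)
    also have "\<dots> = - (c / R * (X powr (2 * \<gamma>) / R powr (2 * \<gamma> + 1))) *\<^sub>R euler \<gamma> f z"
      unfolding \<xi>_def sum_rho_grad_grad[OF \<gamma> x f] X_def R_def by (simp add: scaleR_conv_of_real)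
    also have "c / R * (X powr (2 * \<gamma>) / R powr (2 * \<gamma> + 1)) = c * X powr (2 * \<gamma>) / R powr (2 * \<gamma> + 2)"
      using R by (simp add: powr_add power2_eq_square)
    finally show ?thesis
      unfolding a inner_vec_of_real_mult e_def by simp
  qed
  have Xe: "X powr \<beta> = X powr (\<beta> - \<gamma> * p) * X powr (\<gamma> * p)"
    and Xe': "X powr \<beta> = X powr (\<beta> - \<gamma> * p) * (X powr (\<gamma> * (p - 2)) * X powr (2 * \<gamma>))"
    by (simp_all add: algebra_simps flip: powr_add)
  have Re: "1 / R powr \<alpha> = R powr ((1 + \<gamma>) * p - \<alpha>) / R powr ((\<gamma> + 1) * p)"
    and Re': "1 / R powr \<alpha> = R powr ((1 + \<gamma>) * p - \<alpha>) / (R powr ((\<gamma> + 1) * (p - 2)) * R powr (2 * \<gamma> + 2))"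
    using R by (simp_all add: algebra_simps powr_minus_divide[symmetric] flip: powr_add powr_diff)
  have powr_norm_a: "norm a powr q = c powr q * F powr q * X powr (\<gamma> * q) / R powr ((\<gamma> + 1) * q)" for q
    unfolding na using c F X R by (simp add: powr_mult powr_divide powr_powr)
  have ww: "w z = X powr (\<beta> - \<gamma> * p) * R powr ((1 + \<gamma>) * p - \<alpha>)" and WW: "W z = X powr \<beta> * (1 / R powr \<alpha>)"
    by (simp_all add: w_def W_def X_def R_def)
  show 1: "w z * norm (grad \<gamma> f z - \<eta> z) powr p = c powr p * (W z * norm (f z) powr p)"
    unfolding \<xi>_def[symmetric] a_def[symmetric] powr_norm_a ww WW Xe Re F_def[symmetric] by simp
  have cp: "c powr (p - 1) = c powr (p - 2) * c" and cp': "c powr p = c powr (p - 1) * c"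
    using c by (simp_all add: powr_diff power2_eq_square)
  have 2: "w z * (norm a powr (p - 2) * (a \<bullet> \<xi>)) = - (c powr (p - 1) * (W z * (F powr (p - 2) * e)))"
    unfolding powr_norm_a ia ww WW Xe' Re' cp by simp
  have "w z * C_p p \<xi> (\<eta> z) = w z * norm \<xi> powr p + (p - 1) * (w z * norm a powr p)
      - p * (w z * (norm a powr (p - 2) * (a \<bullet> \<xi>)))"
    unfolding C_p_alt a_def by (simp add: algebra_simps)
  also have "\<dots> = w z * norm \<xi> powr p - c powr p * (W z * F powr p)
      + c powr (p - 1) * (W z * (p * F powr (p - 2) * e + c * p * F powr p))"
    unfolding 2 using 1 by (simp add: a_def \<xi>_def F_def cp' algebra_simps)
  finally show "w z * C_p p (grad \<gamma> f z) (\<eta> z) = w z * norm (grad \<gamma> f z) powr p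
      - c powr p * (W z * norm (f z) powr p)
      + c powr (p - 1) * (W z * (p * norm (f z) powr (p - 2) * (f z \<bullet> euler \<gamma> f z) + c * p * norm (f z) powr p))"
    unfolding \<xi>_def F_def e_def .
qed

text \<open>The inequality of Cauchy and Schwarz, applied to the inner product of the gradient of \<open>f\<close> with
\<open>rho_grad\<close>.\<close>
lemma weighted_euler_le:
  fixes f :: "(real^'m::finite) \<times> (real^'k::finite) \<Rightarrow> complex" and p \<alpha> \<beta> \<gamma> :: real
  assumes \<gamma>: "0 \<le> \<gamma>" and p: "1 < p" and x: "fst z \<noteq> 0" and f: "f differentiable (at z)"
  shows "norm (fst z) powr \<beta> / rho \<gamma> z powr \<alpha> * norm (euler \<gamma> f z) powr p
    \<le> norm (fst z) powr (\<beta> - \<gamma> * p) * rho \<gamma> z powr ((1 + \<gamma>) * p - \<alpha>) * norm (grad \<gamma> f z) powr p"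
proof -
  define X R where "X = norm (fst z)" and "R = rho \<gamma> z"
  have z: "z \<noteq> 0" using x by auto
  have X: "0 < X" and R: "0 < R"
    using x rho_pos[OF \<gamma> z] by (auto simp: X_def R_def)
  have "X powr (2 * \<gamma>) / R powr (2 * \<gamma> + 1) * norm (euler \<gamma> f z)
      = norm (\<Sum>l\<in>UNIV. of_real (rho_grad \<gamma> z $ l) * grad \<gamma> f z $ l)"
    unfolding sum_rho_grad_grad[OF \<gamma> x f] norm_mult norm_of_real by (simp add: X_def R_def)
  also have "\<dots> \<le> X powr \<gamma> / R powr \<gamma> * norm (grad \<gamma> f z)"
    using norm_sum_of_real_mult_le[of "rho_grad \<gamma> z"] by (simp add: norm_rho_grad[OF \<gamma> x] X_def R_def)
  finally have "norm (euler \<gamma> f z) * X powr (2 * \<gamma>) * R powr \<gamma> \<le> norm (grad \<gamma> f z) * X powr \<gamma> * R powr (2 * \<gamma> + 1)"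
    using R by (simp add: field_simps)
  moreover have "X powr (2 * \<gamma>) = X powr \<gamma> * X powr \<gamma>" "R powr (2 * \<gamma> + 1) = R powr \<gamma> * R powr (1 + \<gamma>)"
    by (simp_all flip: powr_add)
  ultimately have "(norm (euler \<gamma> f z) * X powr \<gamma>) * (X powr \<gamma> * R powr \<gamma>)
      \<le> (norm (grad \<gamma> f z) * R powr (1 + \<gamma>)) * (X powr \<gamma> * R powr \<gamma>)"
    by (simp add: mult_ac)
  then have "norm (euler \<gamma> f z) * X powr \<gamma> \<le> norm (grad \<gamma> f z) * R powr (1 + \<gamma>)"
    using X R by (simp add: zero_less_mult_iff)
  then have "(norm (euler \<gamma> f z) * X powr \<gamma>) powr p \<le> (norm (grad \<gamma> f z) * R powr (1 + \<gamma>)) powr p"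
    using p by (intro powr_mono2) auto
  then have le: "norm (euler \<gamma> f z) powr p * X powr (\<gamma> * p) \<le> norm (grad \<gamma> f z) powr p * R powr ((1 + \<gamma>) * p)"
    by (simp add: powr_mult powr_powr)
  have "X powr (\<beta> - \<gamma> * p) / R powr \<alpha> * (norm (euler \<gamma> f z) powr p * X powr (\<gamma> * p))
      \<le> X powr (\<beta> - \<gamma> * p) / R powr \<alpha> * (norm (grad \<gamma> f z) powr p * R powr ((1 + \<gamma>) * p))"
    using le by (rule mult_left_mono) simp
  then show ?thesis
    using X R by (simp add: powr_diff X_def[symmetric] R_def[symmetric] mult_ac)
qed

section \<open>Test functions along the dilations\<close>

text \<open>The first derivatives exist and are continuous on the whole space, because the function vanishes
near every point outside its support.\<close>
lemma test_function_C1: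
  fixes f :: "'a::real_normed_vector \<Rightarrow> 'b::real_normed_vector"
  assumes f: "f \<in> test_functions \<Omega>" and \<Omega>: "open \<Omega>"
  shows "f differentiable (at z)" and "continuous_on UNIV (\<lambda>z. frechet_derivative f (at z) v)"
proof -
  define K where "K = closure {z. f z \<noteq> 0}"
  have K: "open (- K)" "K \<subseteq> \<Omega>" and smooth: "Ck_on (Suc 0) \<Omega> f"
    using f by (auto simp: test_functions_def smooth_on_open_def K_def simp del: Ck_on.simps)
  have off: "(f has_derivative (\<lambda>v. 0)) (at z)" if "z \<in> - K" for z
  proof (rule has_derivative_transform_within_open[OF _ K(1) that])
    show "((\<lambda>z. 0) has_derivative (\<lambda>v. 0)) (at z)" by simp
    show "0 = f x" if "x \<in> - K" for x
      using that closure_subset[of "{z. f z \<noteq> 0}"] by (auto simp: K_def)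
  qed
  have cover: "\<Omega> \<union> - K = UNIV" using K by auto
  show "f differentiable (at z)"
    using off[of z] smooth cover by (cases "z \<in> K") (auto simp: differentiable_def)
  have "continuous_on (- K) (\<lambda>z. frechet_derivative f (at z) v)"
  proof (rule continuous_on_eq)
    show "0 = frechet_derivative f (at z) v" if "z \<in> - K" for z
      using fun_cong[OF frechet_derivative_at[OF off[OF that]], of v] .
  qed simp
  moreover have "continuous_on \<Omega> (\<lambda>z. frechet_derivative f (at z) v)"
    using smooth by simp
  ultimately show "continuous_on UNIV (\<lambda>z. frechet_derivative f (at z) v)"
    using continuous_on_open_Un[OF \<Omega> K(1)] cover by metis
qed

text \<open>On the support \<open>rho\<close> lies between two positive constants, since the support is compact and misses
the origin; a dilation by more than their ratio moves the support off itself.\<close>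
lemma test_function_leaves_support:
  fixes f :: "(real^'m::finite) \<times> (real^'k::finite) \<Rightarrow> 'b::real_normed_vector"
  assumes \<gamma>: "0 \<le> \<gamma>" and f: "f \<in> test_functions (UNIV - {(0, 0)})"
  obtains T where "0 < T" "\<And>z. f z \<noteq> 0 \<Longrightarrow> f (dil \<gamma> T z) = 0"
proof -
  define K where "K = closure {z. f z \<noteq> 0}"
  have K: "compact K" "0 \<notin> K"
    using f by (auto simp: test_functions_def K_def zero_prod_def)
  have supp: "z \<in> K" if "f z \<noteq> 0" for z
    using that closure_subset[of "{z. f z \<noteq> 0}"] by (auto simp: K_def)
  show ?thesis
  proof (cases "K = {}")
    case True
    then show ?thesis using that[of 1] supp by auto
  next
    case False
    obtain a where a: "a \<in> K" "\<And>z. z \<in> K \<Longrightarrow> rho \<gamma> a \<le> rho \<gamma> z"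
      using continuous_attains_inf[OF K(1) False continuous_on_rho[OF \<gamma>]] by blast
    obtain b where b: "b \<in> K" "\<And>z. z \<in> K \<Longrightarrow> rho \<gamma> z \<le> rho \<gamma> b"
      using continuous_attains_sup[OF K(1) False continuous_on_rho[OF \<gamma>]] by blast
    have pos: "0 < rho \<gamma> a" "0 < rho \<gamma> b"
      using a(1) b(1) K(2) by (auto intro!: rho_pos[OF \<gamma>])
    define T where "T = ln (rho \<gamma> b / rho \<gamma> a) + 1"
    have "1 \<le> rho \<gamma> b / rho \<gamma> a" using pos b(2)[OF a(1)] by simp
    then have T: "0 < T" by (simp add: T_def add_nonneg_pos)
    have "f (dil \<gamma> T z) = 0" if "f z \<noteq> 0" for z
    proof (rule ccontr)
      assume "f (dil \<gamma> T z) \<noteq> 0"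
      then have "exp T * rho \<gamma> z \<le> rho \<gamma> b"
        using b(2)[OF supp] by (fastforce simp add: rho_dil[OF \<gamma>])
      moreover have "exp T * rho \<gamma> a \<le> exp T * rho \<gamma> z"
        using a(2)[OF supp[OF that]] by simp
      moreover have "exp T * rho \<gamma> a = exp 1 * rho \<gamma> b"
        using pos by (simp add: T_def exp_add)
      moreover have "1 * rho \<gamma> b < exp 1 * rho \<gamma> b"
        using pos by (intro mult_strict_right_mono) auto
      ultimately show False by linarith
    qed
    with T show ?thesis using that by blast
  qed
qed

lemma continuous_on_euler:
  fixes f :: "(real^'m::finite) \<times> (real^'k::finite) \<Rightarrow> 'b::real_normed_vector"
  assumes "\<And>z. f differentiable (at z)"
    and "\<And>v. continuous_on UNIV (\<lambda>z. frechet_derivative f (at z) v)"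
  shows "continuous_on UNIV (euler \<gamma> f)"
proof -
  have "linear (frechet_derivative f (at z))" for z
    using assms(1)[of z] by (rule linear_frechet_derivative)
  then have "euler \<gamma> f = (\<lambda>z. (\<Sum>i\<in>UNIV. fst z $ i *\<^sub>R frechet_derivative f (at z) (axis i 1, 0))
      + (\<Sum>j\<in>UNIV. ((1 + \<gamma>) *\<^sub>R snd z) $ j *\<^sub>R frechet_derivative f (at z) (0, axis j 1)))"
    unfolding euler_def by (intro ext linear_prod_expand)
  moreover have "continuous_on UNIV \<dots>"
    by (intro continuous_intros assms(2))
  ultimately show ?thesis by simp
qed

lemma has_vector_derivative_along_dil:
  assumes "f differentiable (at (dil \<gamma> t z))"
  shows "((\<lambda>t. f (dil \<gamma> t z)) has_vector_derivative euler \<gamma> f (dil \<gamma> t z)) (at t)"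
proof -
  have "((\<lambda>t. dil \<gamma> t z) has_derivative
      (\<lambda>s. s *\<^sub>R (fst (dil \<gamma> t z), (1 + \<gamma>) *\<^sub>R snd (dil \<gamma> t z)))) (at t)"
    unfolding dil_def by (auto intro!: derivative_eq_intros simp: mult_ac)
  from has_derivative_compose[OF this, of f "frechet_derivative f (at (dil \<gamma> t z))"]
  have "((\<lambda>t. f (dil \<gamma> t z)) has_derivative
      (\<lambda>s. frechet_derivative f (at (dil \<gamma> t z)) (s *\<^sub>R (fst (dil \<gamma> t z), (1 + \<gamma>) *\<^sub>R snd (dil \<gamma> t z))))) (at t)"
    using assms frechet_derivative_works by blast
  then show ?thesis
    unfolding has_vector_derivative_def euler_def
    by (simp only: linear_cmul[OF linear_frechet_derivative[OF assms]])
qed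

lemma has_real_derivative_norm_powr_along_dil:
  fixes f :: "(real^'m::finite) \<times> (real^'k::finite) \<Rightarrow> 'b::real_inner"
  assumes p: "1 < p" and f: "f differentiable (at (dil \<gamma> t z))"
  shows "((\<lambda>t. norm (f (dil \<gamma> t z)) powr p) has_real_derivative
    p * norm (f (dil \<gamma> t z)) powr (p - 2) * (f (dil \<gamma> t z) \<bullet> euler \<gamma> f (dil \<gamma> t z))) (at t)"
proof -
  have "((\<lambda>t. f (dil \<gamma> t z)) has_derivative (\<lambda>s. s *\<^sub>R euler \<gamma> f (dil \<gamma> t z))) (at t)"
    using has_vector_derivative_along_dil[OF f] by (simp add: has_vector_derivative_def)
  from has_derivative_compose[OF this has_derivative_norm_powr[OF p]] show ?thesis
    unfolding has_field_derivative_def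
    by (rule has_derivative_eq_rhs) (simp add: fun_eq_iff mult_ac)
qed

section \<open>A Hardy inequality along the dilations\<close>

text \<open>Since \<open>f\<close> vanishes at time \<open>T\<close>, the value \<open>f z\<close> is minus the integral of \<open>euler f\<close> along the orbit.
The power is moved inside the integral by integrating the tangent-line inequality at the mean
slope \<open>b = |f z| / T\<close>.\<close>
lemma norm_powr_le_integral_along_dil:
  fixes f :: "(real^'m::finite) \<times> (real^'k::finite) \<Rightarrow> complex"
  assumes p: "1 < p" and T: "0 < T" and f0: "f (dil \<gamma> T z) = 0"
    and f: "\<And>z. f differentiable (at z)" and cont: "continuous_on UNIV (euler \<gamma> f)"
  shows "ennreal (norm (f z) powr p) \<le>
    ennreal (T powr (p - 1)) * (\<integral>\<^sup>+t. indicator {0..T} t * ennreal (norm (euler \<gamma> f (dil \<gamma> t z)) powr p) \<partial>lborel)"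
proof -
  define g where "g = (\<lambda>t. norm (euler \<gamma> f (dil \<gamma> t z)))"
  define b where "b = norm (f z) / T"
  have cE: "continuous_on {0..T} (\<lambda>t. euler \<gamma> f (dil \<gamma> t z))"
    by (intro continuous_on_compose2[OF cont] continuous_intros) auto
  then have cg: "continuous_on {0..T} g"
    unfolding g_def by (intro continuous_on_norm)
  then have cgp: "continuous_on {0..T} (\<lambda>t. g t powr p)"
    by (intro continuous_on_powr' continuous_on_const) (use p in \<open>auto simp: g_def\<close>)
  note int = borel_integrable_atLeastAtMost'[unfolded set_integrable_def]
  have b: "0 \<le> b" using T by (simp add: b_def)
  have "(\<integral>t. indicator {0..T} t *\<^sub>R euler \<gamma> f (dil \<gamma> t z) \<partial>lborel) = f (dil \<gamma> T z) - f (dil \<gamma> 0 z)"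
    by (rule integral_FTC_atLeastAtMost[OF less_imp_le[OF T]
          has_vector_derivative_at_within[OF has_vector_derivative_along_dil[OF f]] cE])
  then have "norm (f z) = norm (\<integral>t. indicator {0..T} t *\<^sub>R euler \<gamma> f (dil \<gamma> t z) \<partial>lborel)"
    using f0 by simp
  also have "\<dots> \<le> (\<integral>t. norm (indicator {0..T} t *\<^sub>R euler \<gamma> f (dil \<gamma> t z)) \<partial>lborel)"
    by (rule integral_norm_bound)
  also have "\<dots> = (\<integral>t. indicator {0..T} t *\<^sub>R g t \<partial>lborel)"
    by (simp add: g_def)
  finally have fg: "b * T \<le> (\<integral>t. indicator {0..T} t *\<^sub>R g t \<partial>lborel)"
    using T by (simp add: b_def)
  have ci: "integrable lborel (\<lambda>t. indicator {0..T} t *\<^sub>R ((p - 1) * b powr p) :: real)"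
    by (intro int continuous_intros)
  have "p * b powr (p - 1) * (b * T) \<le> p * b powr (p - 1) * (\<integral>t. indicator {0..T} t *\<^sub>R g t \<partial>lborel)"
    using fg p by (intro mult_left_mono) auto
  also have "\<dots> = (\<integral>t. p * b powr (p - 1) * (indicator {0..T} t *\<^sub>R g t) \<partial>lborel)"
    by simp
  also have "\<dots> \<le> (\<integral>t. indicator {0..T} t *\<^sub>R ((p - 1) * b powr p) + indicator {0..T} t *\<^sub>R g t powr p \<partial>lborel)"
  proof (rule integral_mono)
    show "integrable lborel (\<lambda>t. p * b powr (p - 1) * (indicator {0..T} t *\<^sub>R g t))"
      by (intro integrable_mult_right int cg)
    show "integrable lborel (\<lambda>t. indicator {0..T} t *\<^sub>R ((p - 1) * b powr p) + indicator {0..T} t *\<^sub>R g t powr p)"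
      by (intro Bochner_Integration.integrable_add ci int cgp)
    show "p * b powr (p - 1) * (indicator {0..T} t *\<^sub>R g t)
        \<le> indicator {0..T} t *\<^sub>R ((p - 1) * b powr p) + indicator {0..T} t *\<^sub>R g t powr p" for t
      using Young_powr[OF p b, of "g t"] by (auto simp: g_def indicator_def mult.assoc)
  qed
  also have "\<dots> = (p - 1) * b powr p * T + (\<integral>t. indicator {0..T} t *\<^sub>R g t powr p \<partial>lborel)"
    using T by (subst Bochner_Integration.integral_add[OF ci int[OF cgp]]) simp
  also have "p * b powr (p - 1) * (b * T) = p * b powr p * T"
    using b by (cases "b = 0") (simp_all add: powr_diff)
  finally have "b powr p * T \<le> (\<integral>t. indicator {0..T} t *\<^sub>R g t powr p \<partial>lborel)"
    by (simp add: algebra_simps)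
  then have "T powr (p - 1) * (b powr p * T) \<le> T powr (p - 1) * (\<integral>t. indicator {0..T} t *\<^sub>R g t powr p \<partial>lborel)"
    by (intro mult_left_mono) auto
  also have "T powr (p - 1) * (b powr p * T) = norm (f z) powr p"
    using T by (simp add: b_def powr_divide powr_diff)
  finally have "ennreal (norm (f z) powr p) \<le> ennreal (T powr (p - 1) * (\<integral>t. indicator {0..T} t *\<^sub>R g t powr p \<partial>lborel))"
    by (rule ennreal_leI)
  also have "\<dots> = ennreal (T powr (p - 1)) * (\<integral>\<^sup>+t. ennreal (indicator {0..T} t *\<^sub>R g t powr p) \<partial>lborel)"
    by (subst nn_integral_eq_integral[OF int[OF cgp]]) (auto simp: ennreal_mult')
  also have "(\<lambda>t. ennreal (indicator {0..T} t *\<^sub>R g t powr p)) = (\<lambda>t. indicator {0..T} t * ennreal (g t powr p))"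
    by (auto simp: indicator_def)
  finally show ?thesis by (simp only: g_def)
qed

text \<open>A Hardy inequality without a sharp constant. It serves to deduce, from the finiteness of the gradient
integral, that the integral of \<open>W |f|\<^sup>p\<close> is finite too, a fact that must be known before
\<open>integral_generator_eq_0\<close> applies. The pointwise bound is integrated against \<open>W\<close>; after exchanging
the integrals, each time slice is the integral of \<open>W |euler f|\<^sup>p\<close> times a factor at most 1.\<close>
lemma nn_integral_norm_powr_le_euler:
  fixes W :: "(real^'m::finite) \<times> (real^'k::finite) \<Rightarrow> real" and f :: "(real^'m) \<times> (real^'k) \<Rightarrow> complex"
  assumes W [measurable]: "W \<in> borel_measurable borel"
    and W0: "\<And>z. 0 \<le> W z" and Wd: "\<And>t z. W (dil \<gamma> t z) = exp (d * t) * W z"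
    and d: "0 \<le> hom_dim CARD('m) CARD('k) \<gamma> + d"
    and p: "1 < p" and T: "0 < T" "\<And>z. f z \<noteq> 0 \<Longrightarrow> f (dil \<gamma> T z) = 0"
    and f: "\<And>z. f differentiable (at z)" and cont: "continuous_on UNIV (euler \<gamma> f)"
  shows "(\<integral>\<^sup>+z. ennreal (W z) * ennreal (norm (f z) powr p) \<partial>lborel)
    \<le> ennreal (T powr p) * (\<integral>\<^sup>+z. ennreal (W z) * ennreal (norm (euler \<gamma> f z) powr p) \<partial>lborel)"
proof -
  let ?E = "\<lambda>z. ennreal (norm (euler \<gamma> f z) powr p)"
  let ?I = "\<integral>\<^sup>+z. ennreal (W z) * ?E z \<partial>lborel"
  have [measurable]: "euler \<gamma> f \<in> borel_measurable borel"
    using cont by (rule borel_measurable_continuous_onI)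
  have "(\<integral>\<^sup>+z. ennreal (W z) * ennreal (norm (f z) powr p) \<partial>lborel)
      \<le> (\<integral>\<^sup>+z. ennreal (T powr (p - 1)) * (\<integral>\<^sup>+t. ennreal (W z) * (indicator {0..T} t * ?E (dil \<gamma> t z)) \<partial>lborel) \<partial>lborel)"
  proof (rule nn_integral_mono)
    fix z
    show "ennreal (W z) * ennreal (norm (f z) powr p)
        \<le> ennreal (T powr (p - 1)) * (\<integral>\<^sup>+t. ennreal (W z) * (indicator {0..T} t * ?E (dil \<gamma> t z)) \<partial>lborel)"
    proof (cases "f z = 0")
      case False
      have "ennreal (W z) * ennreal (norm (f z) powr p)
          \<le> ennreal (W z) * (ennreal (T powr (p - 1)) * (\<integral>\<^sup>+t. indicator {0..T} t * ?E (dil \<gamma> t z) \<partial>lborel))"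
        by (intro mult_left_mono norm_powr_le_integral_along_dil p T f cont False) simp
      then show ?thesis
        by (subst nn_integral_cmult) (simp_all add: mult.left_commute)
    qed simp
  qed
  also have "\<dots> = ennreal (T powr (p - 1)) * (\<integral>\<^sup>+z. (\<integral>\<^sup>+t. ennreal (W z) * (indicator {0..T} t * ?E (dil \<gamma> t z)) \<partial>lborel) \<partial>lborel)"
    by (intro nn_integral_cmult) measurable
  also have "(\<integral>\<^sup>+z. (\<integral>\<^sup>+t. ennreal (W z) * (indicator {0..T} t * ?E (dil \<gamma> t z)) \<partial>lborel) \<partial>lborel)
      = (\<integral>\<^sup>+t. (\<integral>\<^sup>+z. ennreal (W z) * (indicator {0..T} t * ?E (dil \<gamma> t z)) \<partial>lborel) \<partial>lborel)"
    by (rule lborel_pair.Fubini') measurable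
  also have "\<dots> = (\<integral>\<^sup>+t. indicator {0..T} t * (\<integral>\<^sup>+z. ennreal (W z) * ?E (dil \<gamma> t z) \<partial>lborel) \<partial>lborel)"
    by (simp add: mult.left_commute[of _ "indicator _ _"] nn_integral_cmult)
  also have "\<dots> \<le> (\<integral>\<^sup>+t. ?I * indicator {0..T} t \<partial>lborel)"
  proof (rule nn_integral_mono)
    fix t
    show "indicator {0..T} t * (\<integral>\<^sup>+z. ennreal (W z) * ?E (dil \<gamma> t z) \<partial>lborel) \<le> ?I * indicator {0..T} t"
    proof (cases "t \<in> {0..T}")
      case True
      have "(\<integral>\<^sup>+z. ennreal (W z) * ?E (dil \<gamma> t z) \<partial>lborel)
          = ennreal (exp (- (hom_dim CARD('m) CARD('k) \<gamma> + d) * t)) * ?I"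
        by (rule nn_integral_weight_dil) (auto simp: W0 Wd)
      also have "\<dots> \<le> 1 * ?I"
        using mult_nonneg_nonneg[OF d, of t] True by (intro mult_right_mono) (auto simp only: mult_minus_left, auto)
      finally show ?thesis using True by simp
    qed simp
  qed
  also have "\<dots> = ?I * ennreal T"
    using T by (simp add: nn_integral_cmult)
  finally have "(\<integral>\<^sup>+z. ennreal (W z) * ennreal (norm (f z) powr p) \<partial>lborel)
      \<le> ennreal (T powr (p - 1)) * (?I * ennreal T)"
    by (simp add: mult_left_mono)
  also have "\<dots> = ennreal (T powr p) * ?I"
  proof -
    have "ennreal (T powr p) = ennreal (T powr (p - 1)) * ennreal T"
      using T by (subst ennreal_mult[symmetric]) (auto simp: powr_diff)
    then show ?thesis by (simp add: mult_ac)
  qed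
  finally show ?thesis .
qed

section \<open>Integration of the identity\<close>

lemma AE_fst_neq_0:
  "AE z in (lborel :: ((real^'m::finite) \<times> (real^'k::finite)) measure). fst z \<noteq> 0"
proof -
  have "{0} \<times> UNIV \<in> null_sets (lborel :: ((real^'m) \<times> (real^'k)) measure)"
    unfolding lborel_prod[symmetric] null_sets_def
    by (auto simp: lborel.emeasure_pair_measure_Times)
  then show ?thesis
    by (rule AE_I') auto
qed

lemma measurable_norm_grad:
  fixes f :: "(real^'m::finite) \<times> (real^'k::finite) \<Rightarrow> complex"
  assumes f: "\<And>z. f differentiable (at z)"
    and cont: "\<And>v. continuous_on UNIV (\<lambda>z. frechet_derivative f (at z) v)"
  shows "(\<lambda>z. norm (grad \<gamma> f z)) \<in> borel_measurable borel"
proof -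
  have [measurable]: "partial_deriv f v \<in> borel_measurable borel" for v
  proof -
    have "partial_deriv f v = (\<lambda>z. frechet_derivative f (at z) v)"
      using f by (intro ext partial_deriv_eq) (simp add: frechet_derivative_works)
    then show ?thesis
      using borel_measurable_continuous_onI[OF cont] by simp
  qed
  have [measurable]: "fst \<in> borel_measurable (borel :: ((real^'m) \<times> (real^'k)) measure)"
    by (intro borel_measurable_continuous_onI continuous_intros)
  have [measurable]: "(\<lambda>z. grad \<gamma> f z $ l) \<in> borel_measurable borel" for l
    by (cases l) (simp_all add: grad_def)
  show ?thesis
    unfolding norm_vec_def L2_set_def by measurable
qed

text \<open>Formally, the two sides differ by \<open>c\<^sup>p\<^sup>-\<^sup>1\<close> times the integral of \<open>W h\<close>. If the left-hand side is
finite, then so are the other integrals, and \<open>W h\<close> integrates to 0. If it is infinite, then so is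
one of the two integrals on the right, by coercivity of \<open>C_p\<close>.\<close>
lemma hardy_identity_pos:
  fixes f :: "(real^'m::finite) \<times> (real^'k::finite) \<Rightarrow> complex" and c p \<alpha> \<beta> \<gamma> :: real
  defines "w \<equiv> \<lambda>z :: (real^'m) \<times> (real^'k). norm (fst z) powr (\<beta> - \<gamma> * p) * rho \<gamma> z powr ((1 + \<gamma>) * p - \<alpha>)"
    and "W \<equiv> \<lambda>z :: (real^'m) \<times> (real^'k). norm (fst z) powr \<beta> / rho \<gamma> z powr \<alpha>"
    and "\<eta> \<equiv> \<lambda>z. rho \<gamma> z powr (- c) *\<^sub>R grad \<gamma> (\<lambda>w. f w / complex_of_real (rho \<gamma> w powr (- c))) z"
  assumes \<gamma>: "0 \<le> \<gamma>" and p: "1 < p" and c: "0 < c"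
    and cp: "c * p = hom_dim CARD('m) CARD('k) \<gamma> + (\<beta> - \<alpha>)"
    and f: "f \<in> test_functions (UNIV - {(0, 0)})"
  shows "(\<integral>\<^sup>+z. ennreal (w z * norm (grad \<gamma> f z) powr p) \<partial>lborel)
    = ennreal (c powr p) * (\<integral>\<^sup>+z. ennreal (W z * norm (f z) powr p) \<partial>lborel)
      + (\<integral>\<^sup>+z. ennreal (w z * C_p p (grad \<gamma> f z) (\<eta> z)) \<partial>lborel)"
    (is "?A = _ * ?B + ?C")
proof -
  have op: "open (UNIV - {(0, 0) :: (real^'m) \<times> (real^'k)})" by auto
  note C1 = test_function_C1[OF f op]
  note cE = continuous_on_euler[OF C1, of \<gamma>]
  have cf: "continuous_on UNIV f"
    using C1(1) by (auto intro!: continuous_at_imp_continuous_on differentiable_imp_continuous_within)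
  have [measurable]: "f \<in> borel_measurable borel" "euler \<gamma> f \<in> borel_measurable borel"
    using cf cE by (auto intro: borel_measurable_continuous_onI)
  note [measurable] = measurable_norm_grad[OF C1, of \<gamma>] measurable_rho[OF \<gamma>]
  have [measurable]: "fst \<in> borel_measurable (borel :: ((real^'m) \<times> (real^'k)) measure)"
    by (intro borel_measurable_continuous_onI continuous_intros)
  have [measurable]: "w \<in> borel_measurable borel" "W \<in> borel_measurable borel"
    unfolding w_def W_def by measurable
  have w0: "0 \<le> w z" and W0: "0 \<le> W z" for z by (auto simp: w_def W_def)
  have Wd: "W (dil \<gamma> t z) = exp ((\<beta> - \<alpha>) * t) * W z" for t z
  proof -
    have "norm (fst (dil \<gamma> t z)) powr \<beta> = exp (\<beta> * t) * norm (fst z) powr \<beta>"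
      by (simp add: dil_def powr_mult exp_powr_real mult.commute)
    moreover have "rho \<gamma> (dil \<gamma> t z) powr \<alpha> = exp (\<alpha> * t) * rho \<gamma> z powr \<alpha>"
      by (simp add: rho_dil[OF \<gamma>] powr_mult exp_powr_real mult.commute)
    ultimately show ?thesis
      by (simp add: W_def left_diff_distrib exp_diff)
  qed
  define u where "u = (\<lambda>z. norm (f z) powr p)"
  \<comment> \<open>\<open>h = E u + c p u\<close>, and \<open>G\<close> is a measurable representative of the remainder integrand.\<close>
  define h where "h = (\<lambda>z. p * norm (f z) powr (p - 2) * (f z \<bullet> euler \<gamma> f z) + c * p * u z)"
  define G where "G = (\<lambda>z. w z * norm (grad \<gamma> f z) powr p - c powr p * (W z * u z) + c powr (p - 1) * (W z * h z))"
  have cu: "continuous_on UNIV u"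
    unfolding u_def by (intro continuous_on_powr' continuous_intros cf) (use p in auto)
  have ch: "continuous_on UNIV h"
  proof -
    have "h = (\<lambda>z. p * ((norm (f z) powr (p - 2) *\<^sub>R f z) \<bullet> euler \<gamma> f z) + c * p * u z)"
      by (auto simp: h_def)
    moreover have "continuous_on UNIV \<dots>"
      by (intro continuous_intros cu cE continuous_on_compose2[OF continuous_on_norm_powr_scaleR[OF p] cf]) auto
    ultimately show ?thesis by simp
  qed
  have [measurable]: "u \<in> borel_measurable borel" "h \<in> borel_measurable borel"
    using cu ch by (auto intro: borel_measurable_continuous_onI)
  have [measurable]: "G \<in> borel_measurable borel"
    unfolding G_def by measurable
  have pt: "w z * norm (grad \<gamma> f z - \<eta> z) powr p = c powr p * (W z * u z)"
      "w z * C_p p (grad \<gamma> f z) (\<eta> z) = G z" if "fst z \<noteq> 0" for z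
    using weighted_C_p_eq[OF \<gamma> p c that C1(1), of \<beta> \<alpha>]
    by (simp_all only: w_def W_def \<eta>_def u_def G_def h_def)
  have Cp0: "0 \<le> w z * C_p p (grad \<gamma> f z) (\<eta> z)" for z
    by (intro mult_nonneg_nonneg w0 C_p_nonneg p)
  have C: "?C = (\<integral>\<^sup>+z. ennreal (G z) \<partial>lborel)"
    by (rule nn_integral_cong_AE) (use AE_fst_neq_0 in \<open>eventually_elim, simp add: pt\<close>)
  have AE_G: "AE z in lborel. 0 \<le> G z"
    using AE_fst_neq_0 by eventually_elim (use Cp0 pt in metis)
  have B: "?B = (\<integral>\<^sup>+z. ennreal (W z * u z) \<partial>lborel)"
    by (simp only: u_def)
  show ?thesis
  proof (cases "?A = \<infinity>")
    case False
    have "(\<integral>\<^sup>+z. ennreal (W z * norm (euler \<gamma> f z) powr p) \<partial>lborel) \<le> ?A"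
    proof (rule nn_integral_mono_AE)
      show "AE z in lborel. ennreal (W z * norm (euler \<gamma> f z) powr p) \<le> ennreal (w z * norm (grad \<gamma> f z) powr p)"
        using AE_fst_neq_0
        by eventually_elim (intro ennreal_leI, unfold w_def W_def, rule weighted_euler_le[OF \<gamma> p _ C1(1)])
    qed
    then have J: "(\<integral>\<^sup>+z. ennreal (W z * norm (euler \<gamma> f z) powr p) \<partial>lborel) < \<infinity>"
      using False by (auto simp: top.not_eq_extremum)
    obtain T where T: "0 < T" "\<And>z. f z \<noteq> 0 \<Longrightarrow> f (dil \<gamma> T z) = 0"
      using test_function_leaves_support[OF \<gamma> f] by blast
    have d: "0 \<le> hom_dim CARD('m) CARD('k) \<gamma> + (\<beta> - \<alpha>)"
      unfolding cp[symmetric] using c p by simp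
    have "?B \<le> ennreal (T powr p) * (\<integral>\<^sup>+z. ennreal (W z * norm (euler \<gamma> f z) powr p) \<partial>lborel)"
      using nn_integral_norm_powr_le_euler[OF _ W0 Wd d p T C1(1) cE]
      by (simp add: ennreal_mult' W0)
    then have Bfin: "?B < \<infinity>"
      using J by (auto simp: ennreal_mult_less_top intro: le_less_trans)
    have iA: "integrable lborel (\<lambda>z. w z * norm (grad \<gamma> f z) powr p)"
      using False by (intro integrableI_nonneg) (auto simp: w0 top.not_eq_extremum)
    have iu: "integrable lborel (\<lambda>z. W z * u z)"
      using Bfin by (intro integrableI_nonneg) (auto simp: W0 u_def)
    have iE: "integrable lborel (\<lambda>z. W z * norm (euler \<gamma> f z) powr p)"
      using J by (intro integrableI_nonneg) (auto simp: W0)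
    have ih: "integrable lborel (\<lambda>z. W z * h z)"
    proof (rule Bochner_Integration.integrable_bound)
      \<comment> \<open>Young's inequality bounds \<open>|E u| \<le> p |f|\<^sup>p\<^sup>-\<^sup>1 |euler f|\<close> by \<open>(p - 1) u + |euler f|\<^sup>p\<close>.\<close>
      show "integrable lborel (\<lambda>z. (p - 1 + c * p) * (W z * u z) + W z * norm (euler \<gamma> f z) powr p)"
        by (intro Bochner_Integration.integrable_add integrable_mult_right iu iE)
      show "AE z in lborel. norm (W z * h z) \<le> norm ((p - 1 + c * p) * (W z * u z) + W z * norm (euler \<gamma> f z) powr p)"
      proof (rule AE_I2)
        fix z
        have "\<bar>norm (f z) powr (p - 2) * (f z \<bullet> euler \<gamma> f z)\<bar>
            \<le> norm (f z) powr (p - 2) * (norm (f z) * norm (euler \<gamma> f z))"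
          unfolding abs_mult by (intro mult_mono Cauchy_Schwarz_ineq2) auto
        also have "\<dots> = norm (f z) powr (p - 1) * norm (euler \<gamma> f z)"
          by (cases "f z = 0") (simp_all add: powr_diff power2_eq_square)
        finally have "p * \<bar>norm (f z) powr (p - 2) * (f z \<bullet> euler \<gamma> f z)\<bar>
            \<le> p * (norm (f z) powr (p - 1) * norm (euler \<gamma> f z))"
          using p by (intro mult_left_mono) auto
        also have "\<dots> \<le> (p - 1) * u z + norm (euler \<gamma> f z) powr p"
          unfolding u_def using p by (intro Young_powr) auto
        finally have "\<bar>p * norm (f z) powr (p - 2) * (f z \<bullet> euler \<gamma> f z)\<bar> \<le> (p - 1) * u z + norm (euler \<gamma> f z) powr p"
          using p by (simp add: abs_mult mult.assoc)
        moreover have "0 \<le> c * p * u z" using c p by (simp add: u_def)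
        ultimately have "\<bar>h z\<bar> \<le> (p - 1 + c * p) * u z + norm (euler \<gamma> f z) powr p"
          unfolding h_def by (simp add: algebra_simps)
        then have "W z * \<bar>h z\<bar> \<le> W z * ((p - 1 + c * p) * u z + norm (euler \<gamma> f z) powr p)"
          using W0 by (rule mult_left_mono)
        then show "norm (W z * h z) \<le> norm ((p - 1 + c * p) * (W z * u z) + W z * norm (euler \<gamma> f z) powr p)"
          using W0[of z] by (simp add: abs_mult algebra_simps)
      qed
    qed measurable
    have h0: "(\<integral>z. W z * h z \<partial>lborel) = 0"
    proof (rule integral_generator_eq_0[OF _ Wd cu ch iu ih])
      fix t z
      have "((\<lambda>t. exp (c * p * t) * u (dil \<gamma> t z)) has_real_derivative
          (c * p * exp (c * p * t)) * u (dil \<gamma> t z)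
          + p * norm (f (dil \<gamma> t z)) powr (p - 2) * (f (dil \<gamma> t z) \<bullet> euler \<gamma> f (dil \<gamma> t z)) * exp (c * p * t)) (at t)"
        unfolding u_def
        by (intro DERIV_mult has_real_derivative_norm_powr_along_dil p C1) (auto intro!: derivative_eq_intros)
      then show "((\<lambda>t. exp ((hom_dim CARD('m) CARD('k) \<gamma> + (\<beta> - \<alpha>)) * t) * u (dil \<gamma> t z)) has_real_derivative
          exp ((hom_dim CARD('m) CARD('k) \<gamma> + (\<beta> - \<alpha>)) * t) * h (dil \<gamma> t z)) (at t)"
        unfolding cp[symmetric] by (simp add: h_def algebra_simps)
    qed measurable
    have iG: "integrable lborel G"
      unfolding G_def by (intro Bochner_Integration.integrable_add Bochner_Integration.integrable_diff integrable_mult_right iA iu ih)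
    have "integral\<^sup>L lborel G = (\<integral>z. w z * norm (grad \<gamma> f z) powr p \<partial>lborel) - c powr p * (\<integral>z. W z * u z \<partial>lborel)"
      unfolding G_def
      by (simp add: Bochner_Integration.integral_add Bochner_Integration.integral_diff iA iu ih h0)
    then have "(\<integral>z. w z * norm (grad \<gamma> f z) powr p \<partial>lborel) = c powr p * (\<integral>z. W z * u z \<partial>lborel) + integral\<^sup>L lborel G"
      by simp
    moreover have "0 \<le> (\<integral>z. W z * u z \<partial>lborel)" "0 \<le> integral\<^sup>L lborel G"
      using AE_G W0 by (auto intro!: integral_nonneg_AE simp: u_def)
    ultimately show ?thesis
      unfolding B C using nn_integral_eq_integral[OF iA] nn_integral_eq_integral[OF iu] nn_integral_eq_integral[OF iG AE_G]
      by (simp add: w0 W0 u_def ennreal_mult)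
  next
    case True
    define K where "K = 2 * (p - 1) * 2 powr (p / (p - 1)) * c powr p"
    have K: "0 \<le> K" using p by (simp add: K_def)
    have "?A \<le> (\<integral>\<^sup>+z. 2 * ennreal (G z) + ennreal K * ennreal (W z * u z) \<partial>lborel)"
    proof (rule nn_integral_mono_AE)
      show "AE z in lborel. ennreal (w z * norm (grad \<gamma> f z) powr p) \<le> 2 * ennreal (G z) + ennreal K * ennreal (W z * u z)"
        using AE_fst_neq_0
      proof eventually_elim
        fix z :: "(real^'m) \<times> (real^'k)" assume z: "fst z \<noteq> 0"
        have G0: "0 \<le> G z" using Cp0[of z] pt(2)[OF z] by simp
        have "w z * norm (grad \<gamma> f z) powr p \<le> w z * (2 * C_p p (grad \<gamma> f z) (\<eta> z)
            + 2 * (p - 1) * 2 powr (p / (p - 1)) * norm (grad \<gamma> f z - \<eta> z) powr p)"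
          by (intro mult_left_mono norm_powr_le_C_p p w0)
        also have "\<dots> = 2 * (w z * C_p p (grad \<gamma> f z) (\<eta> z))
            + 2 * (p - 1) * 2 powr (p / (p - 1)) * (w z * norm (grad \<gamma> f z - \<eta> z) powr p)"
          by (simp add: distrib_left mult_ac)
        also have "\<dots> = 2 * G z + K * (W z * u z)"
          unfolding pt[OF z] K_def by simp
        finally have "ennreal (w z * norm (grad \<gamma> f z) powr p) \<le> ennreal (2 * G z + K * (W z * u z))"
          by (rule ennreal_leI)
        then show "ennreal (w z * norm (grad \<gamma> f z) powr p) \<le> 2 * ennreal (G z) + ennreal K * ennreal (W z * u z)"
          using K G0 W0[of z] by (simp add: ennreal_mult' u_def)
      qed
    qed
    also have "\<dots> = 2 * ?C + ennreal K * ?B"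
      unfolding C B by (simp add: nn_integral_add nn_integral_cmult)
    finally have "2 * ?C + ennreal K * ?B = \<infinity>"
      using True by (simp add: top_unique)
    then have "?C = \<infinity> \<or> ?B = \<infinity>"
      by (auto simp: ennreal_mult_eq_top_iff)
    then show ?thesis
      using True c by (auto simp: ennreal_mult_eq_top_iff ennreal_top_mult)
  qed
qed

theorem corollary3p2:
  fixes p \<alpha> \<beta> \<gamma> Q :: real
    and f :: "(real^'m::finite) \<times> (real^'k::finite) \<Rightarrow> complex"
  assumes "0 \<le> \<gamma>"
    and "1 < p"
    and "Q = hom_dim CARD('m) CARD('k) \<gamma>"
    and "Q \<ge> \<alpha> - \<beta>"
    and "f \<in> test_functions (UNIV - {(0, 0)})"
  shows "(\<integral>\<^sup>+z. ennreal (norm (fst z) powr (\<beta> - \<gamma> * p) * rho \<gamma> z powr ((1 + \<gamma>) * p - \<alpha>)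
             * norm (grad \<gamma> f z) powr p) \<partial>lborel)
       = ennreal (((Q + \<beta> - \<alpha>) / p) powr p)
           * (\<integral>\<^sup>+z. ennreal (norm (fst z) powr \<beta> / rho \<gamma> z powr \<alpha> * norm (f z) powr p) \<partial>lborel)
         + (\<integral>\<^sup>+z. ennreal (norm (fst z) powr (\<beta> - \<gamma> * p) * rho \<gamma> z powr ((1 + \<gamma>) * p - \<alpha>)
             * C_p p (grad \<gamma> f z)
                 (rho \<gamma> z powr (- ((Q + \<beta> - \<alpha>) / p)) *\<^sub>R
                   grad \<gamma> (\<lambda>w. f w / complex_of_real (rho \<gamma> w powr (- ((Q + \<beta> - \<alpha>) / p)))) z)) \<partial>lborel)"
proof -
  define c where "c = (Q + \<beta> - \<alpha>) / p"
  have cp: "c * p = hom_dim CARD('m) CARD('k) \<gamma> + (\<beta> - \<alpha>)"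
    using assms(2,3) by (simp add: c_def)
  have "0 \<le> c"
    using assms(2,4) by (simp add: c_def)
  then consider "0 < c" | "c = 0" by linarith
  then show ?thesis
  proof cases
    case 1
    then show ?thesis
      unfolding c_def[symmetric] by (rule hardy_identity_pos[OF assms(1,2) _ cp assms(5)])
  next
    \<comment> \<open>For \<open>c = 0\<close> both arguments of \<open>C_p\<close> agree away from \<open>x = 0\<close>, and \<open>0 powr p = 0\<close>.\<close>
    case c0: 2
    have "open (UNIV - {(0, 0) :: (real^'m) \<times> (real^'k)})" by auto
    note diff = test_function_C1(1)[OF assms(5) this]
    have "C_p p (grad \<gamma> f z) (rho \<gamma> z powr (- c) *\<^sub>R grad \<gamma> (\<lambda>w. f w / complex_of_real (rho \<gamma> w powr (- c))) z)
        = norm (grad \<gamma> f z) powr p" if "fst z \<noteq> 0" for z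
      using grad_diff_quotient[OF assms(1) that diff, of c] by (simp add: C_p_alt c0 zero_vec_def[symmetric])
    then have "(\<integral>\<^sup>+z. ennreal (norm (fst z) powr (\<beta> - \<gamma> * p) * rho \<gamma> z powr ((1 + \<gamma>) * p - \<alpha>)
             * norm (grad \<gamma> f z) powr p) \<partial>lborel)
        = (\<integral>\<^sup>+z. ennreal (norm (fst z) powr (\<beta> - \<gamma> * p) * rho \<gamma> z powr ((1 + \<gamma>) * p - \<alpha>)
             * C_p p (grad \<gamma> f z)
                 (rho \<gamma> z powr (- c) *\<^sub>R grad \<gamma> (\<lambda>w. f w / complex_of_real (rho \<gamma> w powr (- c))) z)) \<partial>lborel)"
      by (intro nn_integral_cong_AE) (use AE_fst_neq_0 in \<open>eventually_elim, simp\<close>)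
    then show ?thesis
      unfolding c_def[symmetric] using c0 by simp
  qed
qed

end
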